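(* Let $R=4$ and $B=\{0,2\}$. Then for every integer $k\ge 0$, with $L(5^k):=\{0,5^k\}$, the set $\Gamma(L(5^k))$ is an ONB for $L^2(\mu_B)$.
   Context: $\mu_B$ is the unique Borel probability measure on $\mathbb{R}$ satisfying $\mu_B=\frac12\left(\mu_B\circ\tau_0^{-1}+\mu_B\circ\tau_2^{-1}\right)$, where $\tau_b(x)=(x+b)/4$ for $b\in\{0,2\}$. For a finite set $L\subset\mathbb{R}$ with $0\in L$ (and $R=4$), $\Gamma(L)=\{\sum_{j=0}^n 4^j l_j : l_j\in L,\ n\ge 0\}$. Thus $\Gamma(\{0,5^k\})=\{\sum_{j=0}^n 4^j l_j : l_j\in\{0,5^k\},\ n\ge 0\}$. A set $\Gamma\subset\mathbb{R}$ is said to be an ONB for $L^2(\mu)$ if the exponentials $\{e^{2\pi i\gamma x} : \gamma\in\Gamma\}$ form an orthonormal basis of $L^2(\mu)$. *)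

theory Defs
  imports "HOL-Probability.Probability"
begin

definition tau :: "real \<Rightarrow> real \<Rightarrow> real"
  where "tau b x = (x + b) / 4"

definition mu_B_invariant :: "real measure \<Rightarrow> bool"
  where "mu_B_invariant \<mu> \<longleftrightarrow> prob_space \<mu> \<and> sets \<mu> = sets borel \<and>
    (\<forall>A\<in>sets borel. measure \<mu> A = (measure \<mu> (tau 0 -` A) + measure \<mu> (tau 2 -` A)) / 2)"

text \<open>The definite description is well defined by \<open>mu_B_invariant_ex1\<close> below.\<close>

definition mu_B :: "real measure"
  where "mu_B = (THE \<mu>. mu_B_invariant \<mu>)"

definition Gamma_set :: "real set \<Rightarrow> real set"
  where "Gamma_set L = {(\<Sum>j\<le>n. 4 ^ j * l j) | n l. \<forall>j\<le>n. l j \<in> L}"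

definition L2_functions :: "'a measure \<Rightarrow> ('a \<Rightarrow> complex) set"
  where "L2_functions M = {f \<in> borel_measurable M. integrable M (\<lambda>x. (norm (f x))\<^sup>2)}"

definition L2_inner :: "'a measure \<Rightarrow> ('a \<Rightarrow> complex) \<Rightarrow> ('a \<Rightarrow> complex) \<Rightarrow> complex"
  where "L2_inner M f g = (\<integral>x. f x * cnj (g x) \<partial>M)"

definition L2_norm :: "'a measure \<Rightarrow> ('a \<Rightarrow> complex) \<Rightarrow> real"
  where "L2_norm M f = sqrt (\<integral>x. (norm (f x))\<^sup>2 \<partial>M)"

text \<open>An orthonormal basis of the Hilbert space of square-integrable functions modulo
  almost-everywhere equality, given by representatives: an orthonormal family whose finite linear
  combinations are dense. The family is indexed, so distinct indices must give orthogonal (in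
  particular distinct) elements.\<close>

definition L2_orthonormal_basis :: "'a measure \<Rightarrow> 'i set \<Rightarrow> ('i \<Rightarrow> 'a \<Rightarrow> complex) \<Rightarrow> bool"
  where "L2_orthonormal_basis M I e \<longleftrightarrow>
    (\<forall>i\<in>I. e i \<in> L2_functions M) \<and>
    (\<forall>i\<in>I. \<forall>j\<in>I. L2_inner M (e i) (e j) = (if i = j then 1 else 0)) \<and>
    (\<forall>f\<in>L2_functions M. \<forall>\<epsilon>>0. \<exists>F c. finite F \<and> F \<subseteq> I \<and>
       L2_norm M (\<lambda>x. f x - (\<Sum>i\<in>F. c i * e i x)) < \<epsilon>)"

definition exponential :: "real \<Rightarrow> real \<Rightarrow> complex"
  where "exponential \<gamma> x = exp (2 * complex_of_real pi * \<i> * complex_of_real \<gamma> * complex_of_real x)"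

definition is_ONB :: "real set \<Rightarrow> real measure \<Rightarrow> bool"
  where "is_ONB \<Gamma> \<mu> \<longleftrightarrow> L2_orthonormal_basis \<mu> \<Gamma> exponential"

lemma tau_measurable [measurable]: "tau b \<in> borel_measurable borel"
  unfolding tau_def by measurable

lemma mu_B_invariant_real_distribution:
  "mu_B_invariant \<mu> \<Longrightarrow> real_distribution \<mu>"
  by (auto simp: mu_B_invariant_def real_distribution_def real_distribution_axioms_def
      dest: sets_eq_imp_space_eq)

definition digit :: "bool \<Rightarrow> real"
  where "digit b = (if b then 2 else 0)"

definition address :: "bool stream \<Rightarrow> real"
  where "address s = (\<Sum>n. digit (s !! n) / 4 ^ Suc n)"

lemma summable_address: "summable (\<lambda>n. digit (s !! n) / 4 ^ Suc n)"
proof (rule summable_comparison_test')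
  show "summable (\<lambda>n. (1/4::real) ^ n)" by (simp add: summable_geometric)
  show "norm (digit (s !! n) / 4 ^ Suc n) \<le> (1/4) ^ n" if "n \<ge> 0" for n
    by (simp add: digit_def power_divide divide_simps)
qed

lemma address_Stream: "address (b ## s) = tau (digit b) (address s)"
proof -
  have "address (b ## s) = (\<Sum>n. digit ((b ## s) !! Suc n) / 4 ^ Suc (Suc n)) + digit b / 4"
    unfolding address_def by (subst suminf_split_head[OF summable_address]) simp
  also have "(\<Sum>n. digit ((b ## s) !! Suc n) / 4 ^ Suc (Suc n))
      = (\<Sum>n. (1/4) * (digit (s !! n) / 4 ^ Suc n))"
    by simp
  also have "\<dots> = 1/4 * address s"
    unfolding address_def by (rule suminf_mult[OF summable_address])
  finally show ?thesis by (simp add: tau_def field_simps)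
qed

lemma integral_bernoulli_half:
  fixes f :: "bool \<Rightarrow> 'b :: {banach, second_countable_topology}"
  shows "(\<integral>b. f b \<partial>measure_pmf (bernoulli_pmf (1/2))) = (1/2) *\<^sub>R (f False + f True)"
  by (subst integral_measure_pmf[of UNIV]) (auto simp: UNIV_bool algebra_simps)

lemma nn_integral_bernoulli_half:
  assumes "\<And>b. f b \<ge> 0"
  shows "(\<integral>\<^sup>+b. ennreal (f b) \<partial>measure_pmf (bernoulli_pmf (1/2)))
    = ennreal ((f False + f True) / 2)"
  by (subst nn_integral_eq_integral)
    (auto intro!: integrable_measure_pmf_finite simp: assms integral_bernoulli_half)

lemma mu_B_invariant_exists: "\<exists>\<mu>. mu_B_invariant \<mu>"
proof -
  define p where "p = bernoulli_pmf (1/2)"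
  define S where "S = stream_space (measure_pmf p)"
  interpret S: prob_space S unfolding S_def by (rule prob_space.prob_space_stream_space[OF prob_space_measure_pmf])
  have addr [measurable]: "address \<in> borel_measurable S"
    unfolding address_def digit_def S_def by measurable
  define \<mu> where "\<mu> = distr S borel address"
  have "prob_space \<mu>" unfolding \<mu>_def by (rule S.prob_space_distr) measurable
  have spS: "space S = UNIV"
    by (simp add: S_def space_stream_space)
  have "measure \<mu> A = (measure \<mu> (tau 0 -` A) + measure \<mu> (tau 2 -` A)) / 2"
    if A [measurable]: "A \<in> sets borel" for A
  proof -
    have T: "tau b -` A \<in> sets borel" for b
      using measurable_sets[OF tau_measurable A, of b] by simp
    have m: "measure \<mu> C = measure S (address -` C)" if "C \<in> sets borel" for C
      unfolding \<mu>_def by (subst measure_distr) (use that in \<open>auto simp: spS\<close>)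
    have X: "address -` A \<in> sets S"
      using measurable_sets[OF addr A] by (simp add: spS)
    have "emeasure S (address -` A)
        = (\<integral>\<^sup>+b. emeasure S {s \<in> space S. b ## s \<in> address -` A} \<partial>measure_pmf p)"
      unfolding S_def by (rule prob_space.emeasure_stream_space[OF prob_space_measure_pmf]) (use X in \<open>simp add: S_def\<close>)
    also have "\<dots> = (\<integral>\<^sup>+b. ennreal (measure \<mu> (tau (digit b) -` A)) \<partial>measure_pmf p)"
      by (intro nn_integral_cong)
        (simp add: m T spS address_Stream S.emeasure_eq_measure vimage_def)
    also have "\<dots> = ennreal ((measure \<mu> (tau 0 -` A) + measure \<mu> (tau 2 -` A)) / 2)"
      unfolding p_def by (subst nn_integral_bernoulli_half) (simp_all add: digit_def)
    finally show ?thesis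
      by (simp add: m[OF A] S.emeasure_eq_measure)
  qed
  then have "mu_B_invariant \<mu>"
    using \<open>prob_space \<mu>\<close> by (auto simp: mu_B_invariant_def \<mu>_def)
  then show ?thesis ..
qed

lemma mu_B_invariant_distr:
  assumes "mu_B_invariant \<mu>"
  shows "\<mu> = distr (measure_pmf (bernoulli_pmf (1/2)) \<Otimes>\<^sub>M \<mu>) borel (\<lambda>(b, x). tau (digit b) x)"
    (is "_ = distr (?P \<Otimes>\<^sub>M _) _ ?g")
proof (rule measure_eqI)
  interpret real_distribution \<mu> using assms by (rule mu_B_invariant_real_distribution)
  have [measurable]: "?g \<in> borel_measurable (?P \<Otimes>\<^sub>M \<mu>)"
    unfolding tau_def digit_def by measurable
  show "sets \<mu> = sets (distr (?P \<Otimes>\<^sub>M \<mu>) borel ?g)" by simp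
  fix A assume "A \<in> sets \<mu>"
  then have A [measurable]: "A \<in> sets borel" by simp
  have "emeasure (distr (?P \<Otimes>\<^sub>M \<mu>) borel ?g) A
      = emeasure (?P \<Otimes>\<^sub>M \<mu>) (?g -` A \<inter> space (?P \<Otimes>\<^sub>M \<mu>))"
    by (rule emeasure_distr) simp_all
  also have "\<dots> = (\<integral>\<^sup>+b. emeasure \<mu> (Pair b -` (?g -` A \<inter> space (?P \<Otimes>\<^sub>M \<mu>))) \<partial>?P)"
    by (rule emeasure_pair_measure_alt) measurable
  also have "\<dots> = (\<integral>\<^sup>+b. ennreal (measure \<mu> (tau (digit b) -` A)) \<partial>?P)"
    by (intro nn_integral_cong) (simp add: emeasure_eq_measure vimage_def space_pair_measure)
  also have "\<dots> = ennreal ((measure \<mu> (tau 0 -` A) + measure \<mu> (tau 2 -` A)) / 2)"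
    by (subst nn_integral_bernoulli_half) (simp_all add: digit_def)
  also have "\<dots> = emeasure \<mu> A"
    using assms by (simp add: mu_B_invariant_def emeasure_eq_measure)
  finally show "emeasure \<mu> A = emeasure (distr (?P \<Otimes>\<^sub>M \<mu>) borel ?g) A" by simp
qed

lemma mu_B_invariant_char:
  assumes "mu_B_invariant \<mu>"
  shows "char \<mu> t = (1 + iexp (t / 2)) / 2 * char \<mu> (t / 4)"
proof -
  let ?P = "measure_pmf (bernoulli_pmf (1/2))"
  let ?g = "\<lambda>(b, x). tau (digit b) x"
  interpret real_distribution \<mu> using assms by (rule mu_B_invariant_real_distribution)
  interpret pair_prob_space ?P \<mu> ..
  have g [measurable]: "?g \<in> borel_measurable (?P \<Otimes>\<^sub>M \<mu>)"
    unfolding tau_def digit_def by measurable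
  have int: "integrable (?P \<Otimes>\<^sub>M \<mu>) (\<lambda>z. iexp (t * ?g z))"
    by (rule P.integrable_const_bound[where B = 1]) auto
  have "char \<mu> t = (CLINT z|?P \<Otimes>\<^sub>M \<mu>. iexp (t * ?g z))"
    unfolding char_def by (subst mu_B_invariant_distr[OF assms], rule integral_distr) auto
  also have "\<dots> = (CLINT b|?P. CLINT x|\<mu>. iexp (t * ?g (b, x)))"
    by (rule integral_fst'[symmetric, OF int])
  also have "\<dots> = (CLINT b|?P. iexp (t * digit b / 4) * char \<mu> (t / 4))"
  proof (rule Bochner_Integration.integral_cong[OF refl])
    fix b
    have "iexp (t * ?g (b, x)) = iexp (t * digit b / 4) * iexp (t / 4 * x)" for x
      by (simp add: tau_def exp_add[symmetric] field_simps)
    then show "(CLINT x|\<mu>. iexp (t * ?g (b, x))) = iexp (t * digit b / 4) * char \<mu> (t / 4)"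
      by (simp add: char_def)
  qed
  also have "\<dots> = (1 + iexp (t / 2)) / 2 * char \<mu> (t / 4)"
    unfolding integral_bernoulli_half by (simp add: digit_def scaleR_conv_of_real field_simps)
  finally show ?thesis .
qed

lemma mu_B_invariant_unique:
  assumes "mu_B_invariant \<mu>" "mu_B_invariant \<nu>"
  shows "\<mu> = \<nu>"
proof -
  interpret M: real_distribution \<mu> using assms(1) by (rule mu_B_invariant_real_distribution)
  interpret N: real_distribution \<nu> using assms(2) by (rule mu_B_invariant_real_distribution)
  define d where "d t = cmod (char \<mu> t - char \<nu> t)" for t
  have step: "d t \<le> d (t / 4)" for t
  proof -
    have "d t = cmod ((1 + iexp (t / 2)) / 2) * d (t / 4)"
      unfolding d_def mu_B_invariant_char[OF assms(1), of t] mu_B_invariant_char[OF assms(2), of t]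
      by (simp only: right_diff_distrib[symmetric] norm_mult)
    moreover have "cmod ((1 + iexp (t / 2)) / 2) \<le> 1"
      using norm_triangle_ineq[of 1 "iexp (t / 2)"] by (simp add: norm_divide)
    moreover have "d (t / 4) \<ge> 0" by (simp add: d_def)
    ultimately show ?thesis
      by (metis mult_left_le_one_le norm_ge_zero)
  qed
  have iter: "d t \<le> d (t / 4 ^ n)" for t n
  proof (induction n)
    case (Suc n)
    then show ?case using step[of "t / 4 ^ n"] by (simp add: field_simps)
  qed simp
  have "d t = 0" for t
  proof -
    have "isCont d 0"
      unfolding d_def by (intro continuous_intros M.isCont_char N.isCont_char)
    moreover have "(\<lambda>n. t / 4 ^ n) \<longlonglongrightarrow> 0"
      by (rule LIMSEQ_divide_realpow_zero) simp
    ultimately have "(\<lambda>n. d (t / 4 ^ n)) \<longlonglongrightarrow> d 0"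
      by (rule isCont_tendsto_compose)
    then have "d t \<le> d 0"
      by (rule LIMSEQ_le_const) (use iter in blast)
    then show ?thesis by (simp add: d_def M.char_zero N.char_zero)
  qed
  then have "char \<mu> = char \<nu>" by (auto simp: d_def fun_eq_iff)
  then show ?thesis
    by (rule Levy_uniqueness[OF M.real_distribution_axioms N.real_distribution_axioms])
qed

lemma mu_B_invariant_ex1: "\<exists>!\<mu>. mu_B_invariant \<mu>"
  using mu_B_invariant_exists mu_B_invariant_unique by blast

lemma mu_B_invariant_mu_B: "mu_B_invariant mu_B"
  unfolding mu_B_def by (rule theI'[OF mu_B_invariant_ex1])

end

theory Submission
  imports Defs
begin

text \<open>
  Put \<open>L = 5 ^ k\<close>, write \<open>e\<^sub>t\<close> for the exponential of frequency \<open>t\<close>, \<open>\<phi>(t)\<close> for the integral of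
  \<open>e\<^sub>t\<close> against the measure, and \<open>p = \<bar>\<phi>\<bar>\<^sup>2\<close>. Self-similarity of the measure gives
  \<open>p(t) = cos\<^sup>2(\<pi>t/2) p(t/4)\<close>. The inner product of \<open>e\<^sub>s\<close> and \<open>e\<^sub>t\<close> is \<open>\<phi>(s - t)\<close>, and the difference
  of two distinct elements of \<open>\<Gamma>\<close> is a power of 4 times an odd integer, where \<open>p\<close> vanishes; this is
  orthonormality (\<open>Gamma_set_orthonormal\<close>).

  For completeness it suffices to approximate every \<open>e\<^sub>t\<close>, since the measure has bounded support
  and trigonometric polynomials with arbitrary real frequencies are then dense
  (\<open>exponentials_total\<close>, by Stone--Weierstrass and a Dynkin-class argument). The squared distance
  from \<open>e\<^sub>t\<close> to the closed span of the family is \<open>1 - h(t)\<close>, where \<open>h(t)\<close> is the sum of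
  \<open>p(t - \<gamma>)\<close> over \<open>\<gamma> \<in> \<Gamma>\<close>, so the claim is that \<open>h = 1\<close>. Splitting \<open>\<Gamma>\<close> as the disjoint union of
  \<open>4\<Gamma>\<close> and \<open>4\<Gamma> + L\<close> yields
  \<open>h(t) = cos\<^sup>2(\<pi>t/2) h(t/4) + sin\<^sup>2(\<pi>t/2) h((t - L)/4)\<close>. Bessel's inequality gives \<open>h \<le> 1\<close>, and
  \<open>h(0) = 1\<close>.

  The lower bound \<open>h \<ge> 1\<close> (\<open>harmonic_ge_one\<close>) is a minimum principle. As a supremum of continuous
  functions, \<open>h\<close> is lower semicontinuous, so it attains its minimum on a large symmetric interval,
  which both maps \<open>t \<mapsto> t/4\<close> and \<open>t \<mapsto> (t - L)/4\<close> preserve. As \<open>h(t)\<close> is a convex combination of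
  the values at the two images, the images with nonzero weight of a minimizer are again minimizers.
  If some minimizer is not an integer, neither weight vanishes along its orbit under \<open>t \<mapsto> t/4\<close>,
  which tends to 0, so the minimum is at least \<open>h(0) = 1\<close>. If all minimizers are integers, following
  the branch of weight 1 gives an integer orbit \<open>x\<^sub>n\<close> with \<open>4x\<^sub>n\<^sub>+\<^sub>1 \<equiv> x\<^sub>n\<close> modulo \<open>5 ^ k\<close>. Since \<open>-1\<close> is a
  power of 4 modulo \<open>5 ^ k\<close>, two members of the orbit eventually lying in \<open>[-L/3, 0]\<close> have sum
  divisible by \<open>L\<close>, which forces both to be 0 (\<open>integer_orbit_hits_zero\<close>); so 0 is a minimizer.
  This is the only place where the choice \<open>L = 5 ^ k\<close>, rather than an arbitrary odd \<open>L\<close>, matters.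
\<close>

section \<open>Closed subspaces of the space of square-integrable functions\<close>

lemma norm_add_power2_le:
  fixes a b :: "'a::real_normed_vector"
  shows "(norm (a + b))\<^sup>2 \<le> 2 * (norm a)\<^sup>2 + 2 * (norm b)\<^sup>2"
proof -
  have "(norm (a + b))\<^sup>2 \<le> (norm a + norm b)\<^sup>2"
    by (intro power_mono norm_triangle_ineq) simp
  also have "\<dots> \<le> 2 * (norm a)\<^sup>2 + 2 * (norm b)\<^sup>2"
    using zero_le_power2[of "norm a - norm b"] by (simp add: power2_eq_square algebra_simps)
  finally show ?thesis .
qed

lemma L2_functionsD:
  assumes "f \<in> L2_functions M"
  shows "f \<in> borel_measurable M" "integrable M (\<lambda>x. (norm (f x))\<^sup>2)"
  using assms by (auto simp: L2_functions_def)

lemma L2_functions_dominated: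
  fixes w :: "'a \<Rightarrow> real"
  assumes "f \<in> borel_measurable M" "integrable M (\<lambda>x. (w x)\<^sup>2)"
    and "\<And>x. x \<in> space M \<Longrightarrow> norm (f x) \<le> w x"
  shows "f \<in> L2_functions M"
proof -
  note [measurable] = assms(1)
  have "integrable M (\<lambda>x. (norm (f x))\<^sup>2)"
    by (rule Bochner_Integration.integrable_bound[OF assms(2)])
      (use assms(3) in \<open>auto intro!: AE_I2 power_mono\<close>)
  with assms(1) show ?thesis by (simp add: L2_functions_def)
qed

lemma L2_functions_add:
  assumes "f \<in> L2_functions M" "g \<in> L2_functions M"
  shows "(\<lambda>x. f x + g x) \<in> L2_functions M"
proof -
  note [measurable] = assms[THEN L2_functionsD(1)]
  have "integrable M (\<lambda>x. (norm (f x + g x))\<^sup>2)"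
    by (rule Bochner_Integration.integrable_bound[of M "\<lambda>x. 2 * (norm (f x))\<^sup>2 + 2 * (norm (g x))\<^sup>2"])
      (use assms[THEN L2_functionsD(2)] norm_add_power2_le in \<open>auto intro!: AE_I2\<close>)
  then show ?thesis by (simp add: L2_functions_def)
qed

lemma L2_functions_mult_left:
  assumes "f \<in> L2_functions M"
  shows "(\<lambda>x. c * f x) \<in> L2_functions M"
  using assms by (auto simp: L2_functions_def norm_mult power_mult_distrib)

lemma L2_functions_diff:
  assumes "f \<in> L2_functions M" "g \<in> L2_functions M"
  shows "(\<lambda>x. f x - g x) \<in> L2_functions M"
  using L2_functions_add[OF assms(1) L2_functions_mult_left[OF assms(2), of "-1"]] by simp

lemma L2_functions_sum:
  assumes "finite F" "\<And>i. i \<in> F \<Longrightarrow> f i \<in> L2_functions M"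
  shows "(\<lambda>x. \<Sum>i\<in>F. f i x) \<in> L2_functions M"
  using assms
proof (induction F rule: finite_induct)
  case (insert i F)
  then show ?case by (simp add: L2_functions_add)
qed (simp add: L2_functions_def)

text \<open>The squared distance in \<open>L\<^sup>2\<close>. Working with squares replaces the triangle inequality by its
  version with a factor 2, which is enough for questions of density.\<close>

definition L2_dist2 :: "'a measure \<Rightarrow> ('a \<Rightarrow> complex) \<Rightarrow> ('a \<Rightarrow> complex) \<Rightarrow> real"
  where "L2_dist2 M f g = (\<integral>x. (norm (f x - g x))\<^sup>2 \<partial>M)"

lemma L2_dist2_triangle:
  assumes "f \<in> L2_functions M" "g \<in> L2_functions M" "h \<in> L2_functions M"
  shows "L2_dist2 M f h \<le> 2 * L2_dist2 M f g + 2 * L2_dist2 M g h"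
proof -
  note int = L2_functions_diff[THEN L2_functionsD(2)]
  have "L2_dist2 M f h \<le> (\<integral>x. 2 * (norm (f x - g x))\<^sup>2 + 2 * (norm (g x - h x))\<^sup>2 \<partial>M)"
    unfolding L2_dist2_def
  proof (rule integral_mono)
    show "(norm (f x - h x))\<^sup>2 \<le> 2 * (norm (f x - g x))\<^sup>2 + 2 * (norm (g x - h x))\<^sup>2" for x
      using norm_add_power2_le[of "f x - g x" "g x - h x"] by simp
  qed (use assms in \<open>auto intro!: int Bochner_Integration.integrable_add\<close>)
  also have "\<dots> = 2 * L2_dist2 M f g + 2 * L2_dist2 M g h"
    unfolding L2_dist2_def using assms by (simp add: int)
  finally show ?thesis .
qed

lemma L2_dist2_add_le:
  assumes "f \<in> L2_functions M" "f' \<in> L2_functions M" "g \<in> L2_functions M" "g' \<in> L2_functions M"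
  shows "L2_dist2 M (\<lambda>x. f x + g x) (\<lambda>x. f' x + g' x) \<le> 2 * L2_dist2 M f f' + 2 * L2_dist2 M g g'"
proof -
  have "L2_dist2 M (\<lambda>x. f x + g x) (\<lambda>x. f' x + g' x)
      \<le> 2 * L2_dist2 M (\<lambda>x. f x + g x) (\<lambda>x. f' x + g x) + 2 * L2_dist2 M (\<lambda>x. f' x + g x) (\<lambda>x. f' x + g' x)"
    by (intro L2_dist2_triangle L2_functions_add assms)
  then show ?thesis by (simp add: L2_dist2_def)
qed

lemma L2_dist2_mult_left:
  "L2_dist2 M (\<lambda>x. c * f x) (\<lambda>x. c * g x) = (norm c)\<^sup>2 * L2_dist2 M f g"
  by (simp add: L2_dist2_def right_diff_distrib[symmetric] norm_mult power_mult_distrib)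

text \<open>A closed linear subspace of \<open>L\<^sup>2\<close>, as a set of functions rather than of almost-everywhere
  classes. Closure under limits makes it closed under almost-everywhere equality; a nonempty
  such set contains 0 by scaling.\<close>

definition L2_closed_subspace :: "'a measure \<Rightarrow> ('a \<Rightarrow> complex) set \<Rightarrow> bool"
  where "L2_closed_subspace M C \<longleftrightarrow> C \<subseteq> L2_functions M \<and>
    (\<forall>f\<in>C. \<forall>g\<in>C. (\<lambda>x. f x + g x) \<in> C) \<and> (\<forall>c. \<forall>f\<in>C. (\<lambda>x. c * f x) \<in> C) \<and>
    (\<forall>f\<in>L2_functions M. (\<forall>\<epsilon>>0. \<exists>g\<in>C. L2_dist2 M f g < \<epsilon>) \<longrightarrow> f \<in> C)"

text \<open>The closed linear span of an indexed family: the functions approximable in \<open>L\<^sup>2\<close> by finite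
  linear combinations of the family.\<close>

definition L2_closed_span :: "'a measure \<Rightarrow> 'i set \<Rightarrow> ('i \<Rightarrow> 'a \<Rightarrow> complex) \<Rightarrow> ('a \<Rightarrow> complex) set"
  where "L2_closed_span M I e = {f \<in> L2_functions M. \<forall>\<epsilon>>0. \<exists>F c. finite F \<and> F \<subseteq> I \<and>
    L2_dist2 M f (\<lambda>x. \<Sum>i\<in>F. c i * e i x) < \<epsilon>}"

lemma L2_closed_subspace_closed_span:
  assumes e: "\<And>i. i \<in> I \<Longrightarrow> e i \<in> L2_functions M"
  shows "L2_closed_subspace M (L2_closed_span M I e)"
proof -
  let ?C = "L2_closed_span M I e"
  have comb: "(\<lambda>x. \<Sum>i\<in>F. c i * e i x) \<in> L2_functions M" if "finite F" "F \<subseteq> I" for F c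
    using that e by (intro L2_functions_sum L2_functions_mult_left) auto
  have add: "(\<lambda>x. f x + g x) \<in> ?C" if f: "f \<in> ?C" and g: "g \<in> ?C" for f g
    unfolding L2_closed_span_def
  proof (intro CollectI conjI allI impI)
    have fg: "f \<in> L2_functions M" "g \<in> L2_functions M" using f g by (auto simp: L2_closed_span_def)
    then show "(\<lambda>x. f x + g x) \<in> L2_functions M" by (rule L2_functions_add)
    fix \<epsilon> :: real assume "\<epsilon> > 0"
    then have "\<epsilon> / 4 > 0" by simp
    with f obtain F c where F: "finite F" "F \<subseteq> I" "L2_dist2 M f (\<lambda>x. \<Sum>i\<in>F. c i * e i x) < \<epsilon> / 4"
      unfolding L2_closed_span_def by blast
    from g \<open>\<epsilon> / 4 > 0\<close> obtain G d where G: "finite G" "G \<subseteq> I" "L2_dist2 M g (\<lambda>x. \<Sum>i\<in>G. d i * e i x) < \<epsilon> / 4"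
      unfolding L2_closed_span_def by blast
    define b where "b i = (if i \<in> F then c i else 0) + (if i \<in> G then d i else 0)" for i
    have "(\<Sum>i\<in>F \<union> G. b i * e i x) = (\<Sum>i\<in>F. c i * e i x) + (\<Sum>i\<in>G. d i * e i x)" for x
    proof -
      have "(\<Sum>i\<in>F \<union> G. b i * e i x)
          = (\<Sum>i\<in>F \<union> G. if i \<in> F then c i * e i x else 0) + (\<Sum>i\<in>F \<union> G. if i \<in> G then d i * e i x else 0)"
        unfolding b_def sum.distrib[symmetric] by (intro sum.cong) (auto simp: algebra_simps)
      also have "(\<Sum>i\<in>F \<union> G. if i \<in> F then c i * e i x else 0) = (\<Sum>i\<in>F. c i * e i x)"
        using F(1) G(1) by (intro sum.mono_neutral_cong_right) auto
      also have "(\<Sum>i\<in>F \<union> G. if i \<in> G then d i * e i x else 0) = (\<Sum>i\<in>G. d i * e i x)"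
        using F(1) G(1) by (intro sum.mono_neutral_cong_right) auto
      finally show ?thesis .
    qed
    then have "L2_dist2 M (\<lambda>x. f x + g x) (\<lambda>x. \<Sum>i\<in>F \<union> G. b i * e i x) < \<epsilon>"
      using L2_dist2_add_le[OF fg(1) comb[OF F(1,2), of c] fg(2) comb[OF G(1,2), of d]] F(3) G(3) by simp
    then show "\<exists>F c. finite F \<and> F \<subseteq> I \<and> L2_dist2 M (\<lambda>x. f x + g x) (\<lambda>x. \<Sum>i\<in>F. c i * e i x) < \<epsilon>"
      using F G by (metis finite_UnI Un_least)
  qed
  have mult: "(\<lambda>x. a * f x) \<in> ?C" if f: "f \<in> ?C" for a f
    unfolding L2_closed_span_def
  proof (intro CollectI conjI allI impI)
    show "(\<lambda>x. a * f x) \<in> L2_functions M"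
      using f by (auto simp: L2_closed_span_def intro: L2_functions_mult_left)
    fix \<epsilon> :: real assume "\<epsilon> > 0"
    then have "\<epsilon> / ((norm a)\<^sup>2 + 1) > 0" by (auto intro!: divide_pos_pos add_nonneg_pos)
    with f obtain F c where F: "finite F" "F \<subseteq> I"
        "L2_dist2 M f (\<lambda>x. \<Sum>i\<in>F. c i * e i x) < \<epsilon> / ((norm a)\<^sup>2 + 1)"
      unfolding L2_closed_span_def by blast
    let ?D = "L2_dist2 M f (\<lambda>x. \<Sum>i\<in>F. c i * e i x)"
    have "?D \<ge> 0" by (simp add: L2_dist2_def)
    have "L2_dist2 M (\<lambda>x. a * f x) (\<lambda>x. \<Sum>i\<in>F. (a * c i) * e i x) = (norm a)\<^sup>2 * ?D"
      by (simp add: L2_dist2_mult_left[symmetric] sum_distrib_left mult.assoc)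
    also have "\<dots> \<le> ((norm a)\<^sup>2 + 1) * ?D" using \<open>?D \<ge> 0\<close> by (intro mult_right_mono) auto
    also have "\<dots> < \<epsilon>" using F(3) by (simp add: pos_less_divide_eq add_nonneg_pos mult.commute)
    finally show "\<exists>F c. finite F \<and> F \<subseteq> I \<and> L2_dist2 M (\<lambda>x. a * f x) (\<lambda>x. \<Sum>i\<in>F. c i * e i x) < \<epsilon>"
      using F(1,2) by (intro exI[of _ F] exI[of _ "\<lambda>i. a * c i"]) auto
  qed
  have closed: "f \<in> ?C" if f: "f \<in> L2_functions M" and lim: "\<forall>\<epsilon>>0. \<exists>g\<in>?C. L2_dist2 M f g < \<epsilon>" for f
    unfolding L2_closed_span_def
  proof (intro CollectI conjI allI impI f)
    fix \<epsilon> :: real assume "\<epsilon> > 0"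
    then have "\<epsilon> / 4 > 0" by simp
    with lim obtain g where g: "g \<in> ?C" "L2_dist2 M f g < \<epsilon> / 4" by blast
    from g(1) \<open>\<epsilon> / 4 > 0\<close> obtain F c where F: "finite F" "F \<subseteq> I"
        "L2_dist2 M g (\<lambda>x. \<Sum>i\<in>F. c i * e i x) < \<epsilon> / 4" and "g \<in> L2_functions M"
      unfolding L2_closed_span_def by blast
    then have "L2_dist2 M f (\<lambda>x. \<Sum>i\<in>F. c i * e i x) < \<epsilon>"
      using L2_dist2_triangle[OF f _ comb[OF F(1,2), of c], of g] g(2) by simp
    with F show "\<exists>F c. finite F \<and> F \<subseteq> I \<and> L2_dist2 M f (\<lambda>x. \<Sum>i\<in>F. c i * e i x) < \<epsilon>" by blast
  qed
  show ?thesis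
    unfolding L2_closed_subspace_def using add mult closed by (auto simp: L2_closed_span_def)
qed

lemma L2_closed_subspaceD:
  assumes "L2_closed_subspace M C"
  shows "f \<in> C \<Longrightarrow> f \<in> L2_functions M"
    and "f \<in> C \<Longrightarrow> g \<in> C \<Longrightarrow> (\<lambda>x. f x + g x) \<in> C"
    and "f \<in> C \<Longrightarrow> (\<lambda>x. c * f x) \<in> C"
    and "f \<in> L2_functions M \<Longrightarrow> (\<And>\<epsilon>. \<epsilon> > 0 \<Longrightarrow> \<exists>g\<in>C. L2_dist2 M f g < \<epsilon>) \<Longrightarrow> f \<in> C"
  using assms by (auto simp: L2_closed_subspace_def)

lemma L2_closed_subspace_dominated_limit:
  fixes w :: "'a \<Rightarrow> real"
  assumes C: "L2_closed_subspace M C" and g: "\<And>n. g n \<in> C"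
    and f: "f \<in> borel_measurable M" and lim: "\<And>x. x \<in> space M \<Longrightarrow> (\<lambda>n. g n x) \<longlonglongrightarrow> f x"
    and w: "integrable M (\<lambda>x. (w x)\<^sup>2)" and bound: "\<And>n x. x \<in> space M \<Longrightarrow> norm (g n x) \<le> w x"
  shows "f \<in> C"
proof (rule L2_closed_subspaceD(4)[OF C])
  note gL2 = L2_closed_subspaceD(1)[OF C g]
  note [measurable] = f L2_functionsD(1)[OF gL2]
  have fb: "norm (f x) \<le> w x" if "x \<in> space M" for x
    using lim[OF that, THEN tendsto_norm] bound[OF that] by (auto intro: LIMSEQ_le_const2)
  show "f \<in> L2_functions M"
    using f w fb by (rule L2_functions_dominated)
  have "(\<lambda>n. L2_dist2 M f (g n)) \<longlonglongrightarrow> (\<integral>x. 0 \<partial>M)"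
    unfolding L2_dist2_def
  proof (rule integral_dominated_convergence[where w="\<lambda>x. 4 * (w x)\<^sup>2"])
    show "AE x in M. (\<lambda>n. (norm (f x - g n x))\<^sup>2) \<longlonglongrightarrow> 0"
    proof (rule AE_I2)
      fix x assume "x \<in> space M"
      have "(\<lambda>n. (norm (f x - g n x))\<^sup>2) \<longlonglongrightarrow> (norm (f x - f x))\<^sup>2"
        by (intro tendsto_intros lim \<open>x \<in> space M\<close>)
      then show "(\<lambda>n. (norm (f x - g n x))\<^sup>2) \<longlonglongrightarrow> 0" by simp
    qed
    show "AE x in M. norm ((norm (f x - g n x))\<^sup>2) \<le> 4 * (w x)\<^sup>2" for n
    proof (rule AE_I2)
      fix x assume x: "x \<in> space M"
      have "norm (f x - g n x) \<le> 2 * w x"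
        using norm_triangle_ineq4[of "f x" "g n x"] fb[OF x] bound[OF x, of n] by linarith
      then have "(norm (f x - g n x))\<^sup>2 \<le> (2 * w x)\<^sup>2" by (rule power_mono) simp
      then show "norm ((norm (f x - g n x))\<^sup>2) \<le> 4 * (w x)\<^sup>2" by (simp add: power_mult_distrib)
    qed
  qed (use w in auto)
  then have "(\<lambda>n. L2_dist2 M f (g n)) \<longlonglongrightarrow> 0" by simp
  then show "\<exists>h\<in>C. L2_dist2 M f h < \<epsilon>" if "\<epsilon> > 0" for \<epsilon>
    using order_tendstoD(2)[OF _ that] g by (metis (no_types, lifting) eventually_sequentially order_refl)
qed

lemma (in prob_space) L2_functions_eq_closed_subspace:
  assumes C: "L2_closed_subspace M C"
    and ind: "\<And>A. A \<in> sets M \<Longrightarrow> indicator A \<in> C"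
  shows "C = L2_functions M"
proof
  show "C \<subseteq> L2_functions M" using C by (simp add: L2_closed_subspace_def)
  show "L2_functions M \<subseteq> C"
  proof
    fix f assume f: "f \<in> L2_functions M"
    obtain s where s: "\<And>i. simple_function M (s i)" "\<And>x. x \<in> space M \<Longrightarrow> (\<lambda>i. s i x) \<longlonglongrightarrow> f x"
        "\<And>i x. x \<in> space M \<Longrightarrow> norm (s i x) \<le> 2 * norm (f x)"
      using borel_measurable_implies_sequence_metric[OF L2_functionsD(1)[OF f], of 0]
      unfolding dist_0_norm by (metis dist_0_norm dist_commute norm_conv_dist)
    have sumC: "(\<lambda>x. \<Sum>y\<in>F. y * indicator (A y) x) \<in> C"
      if "finite F" "\<And>y. y \<in> F \<Longrightarrow> A y \<in> sets M" for F and A :: "complex \<Rightarrow> 'a set"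
      using that
    proof (induction F rule: finite_induct)
      case empty
      show ?case using L2_closed_subspaceD(3)[OF C ind[OF sets.top], of 0] by simp
    next
      case (insert y F)
      have "(\<lambda>x. y * indicator (A y) x + (\<Sum>y\<in>F. y * indicator (A y) x)) \<in> C"
        using insert by (intro L2_closed_subspaceD(2,3)[OF C] ind) auto
      then show ?case using insert(1,2) by (simp only: sum.insert not_False_eq_True)
    qed
    have sC: "(\<lambda>x. \<Sum>y\<in>s i ` space M. y * indicator (s i -` {y} \<inter> space M) x) \<in> C" for i
      using s(1)[of i] by (intro sumC) (auto simp: simple_function_def)
    have s_eq: "(\<Sum>y\<in>s i ` space M. y * indicator (s i -` {y} \<inter> space M) x) = s i x" if "x \<in> space M" for i x
    proof -
      have "(\<Sum>y\<in>s i ` space M. y * indicator (s i -` {y} \<inter> space M) x)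
          = (\<Sum>y\<in>s i ` space M. if y = s i x then y else 0)"
        using that by (intro sum.cong) (auto simp: indicator_def)
      also have "\<dots> = s i x"
        using s(1)[of i] that by (simp add: simple_function_def)
      finally show ?thesis .
    qed
    show "f \<in> C"
    proof (rule L2_closed_subspace_dominated_limit[OF C sC])
      show "integrable M (\<lambda>x. (2 * norm (f x))\<^sup>2)"
        using L2_functionsD(2)[OF f] by (simp add: power_mult_distrib)
    qed (use s s_eq L2_functionsD(1)[OF f] in auto)
  qed
qed

section \<open>Density of the exponentials\<close>

lemma exponential_0 [simp]: "exponential 0 x = 1"
  by (simp add: exponential_def)

lemma exponential_mult: "exponential s x * exponential t x = exponential (s + t) x"
  by (simp add: exponential_def exp_add[symmetric] algebra_simps)

lemma cnj_exponential: "cnj (exponential t x) = exponential (- t) x"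
  by (simp add: exponential_def exp_cnj)

lemma norm_exponential [simp]: "norm (exponential t x) = 1"
  by (simp add: exponential_def norm_exp_eq_Re)

lemma continuous_on_exponential: "continuous_on S (exponential t)"
  unfolding exponential_def by (intro continuous_intros)

lemma exponential_measurable [measurable]: "exponential t \<in> borel_measurable borel"
  by (intro borel_measurable_continuous_onI continuous_on_exponential)

lemma (in real_distribution) exponential_L2: "exponential t \<in> L2_functions M"
  by (rule L2_functions_dominated[of _ _ "\<lambda>_. 1"]) auto

text \<open>Trigonometric polynomials on the line, with arbitrary real frequencies.\<close>

inductive trig_poly :: "(real \<Rightarrow> complex) \<Rightarrow> bool" where
  exponential: "trig_poly (exponential t)"
| add: "trig_poly f \<Longrightarrow> trig_poly g \<Longrightarrow> trig_poly (\<lambda>x. f x + g x)"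
| scale: "trig_poly f \<Longrightarrow> trig_poly (\<lambda>x. c * f x)"

lemma trig_poly_mult:
  assumes "trig_poly f" "trig_poly g"
  shows "trig_poly (\<lambda>x. f x * g x)"
  using assms(1)
proof induction
  case (exponential t)
  from assms(2) show ?case
  proof induction
    case (exponential s)
    show ?case using trig_poly.exponential[of "t + s"] by (simp add: exponential_mult)
  next
    case (add f g)
    then show ?case using trig_poly.add by (simp add: distrib_left)
  next
    case (scale f c)
    then show ?case using trig_poly.scale[of _ c] by (simp add: mult.left_commute)
  qed
next
  case (add f1 f2)
  then show ?case using trig_poly.add by (simp add: distrib_right)
next
  case (scale f c)
  then show ?case using trig_poly.scale[of _ c] by (simp add: mult.assoc)
qed

lemma trig_poly_const: "trig_poly (\<lambda>_. c)"
  using trig_poly.scale[OF trig_poly.exponential[of 0], of c] by simp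

lemma trig_poly_sin: "trig_poly (\<lambda>x. complex_of_real (sin (2 * pi * t * x)))"
proof -
  have "complex_of_real (sin (2 * pi * t * x))
      = 1 / (2 * \<i>) * exponential t x + - 1 / (2 * \<i>) * exponential (- t) x" for x
    by (simp add: exponential_def sin_exp_eq divide_simps sin_of_real[symmetric] algebra_simps)
  then show ?thesis by (simp only: trig_poly.intros)
qed

lemma trig_poly_continuous: "trig_poly f \<Longrightarrow> continuous_on S f"
  by (induction rule: trig_poly.induct)
    (auto intro!: continuous_intros continuous_on_exponential)

lemma trig_poly_in_closed_subspace:
  assumes "L2_closed_subspace M C" "\<And>t. exponential t \<in> C" "trig_poly f"
  shows "f \<in> C"
  using assms(3) by induction (auto intro: assms(2) L2_closed_subspaceD(2,3)[OF assms(1)])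

text \<open>Arbitrary real frequencies matter here: a sine of period \<open>4r\<close> separates the points of
  \<open>[-r, r]\<close>, whatever the size of the interval.\<close>

lemma trig_poly_uniform_approx:
  assumes "continuous_on {-r..r} g" "0 < e"
  shows "\<exists>f. trig_poly (\<lambda>x. complex_of_real (f x)) \<and> (\<forall>x\<in>{-r..r}. \<bar>g x - f x\<bar> < e)"
proof (rule Stone_Weierstrass_HOL[of "{-r..r}" "\<lambda>f. trig_poly (\<lambda>x. complex_of_real (f x))"])
  show "trig_poly (\<lambda>x. complex_of_real c)" for c by (rule trig_poly_const)
  show "continuous_on {-r..r} f" if "trig_poly (\<lambda>x. complex_of_real (f x))" for f
    using continuous_on_Re[OF trig_poly_continuous[OF that]] by simp
  fix x y assume xy: "x \<in> {-r..r} \<and> y \<in> {-r..r} \<and> x \<noteq> y"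
  then have r: "r > 0" by auto
  define t where "t = 1 / (4 * r)"
  have t: "2 * pi * t * z = pi / 2 * (z / r)" for z by (simp add: t_def)
  have range: "- (pi / 2) \<le> 2 * pi * t * z \<and> 2 * pi * t * z \<le> pi / 2" if "z \<in> {-r..r}" for z
  proof -
    have "-1 \<le> z / r" "z / r \<le> 1" using that r by (auto simp: field_simps)
    then have "pi / 2 * (-1) \<le> pi / 2 * (z / r)" "pi / 2 * (z / r) \<le> pi / 2 * 1"
      by (intro mult_left_mono; simp)+
    then show ?thesis by (simp add: t)
  qed
  have "sin (2 * pi * t * x) \<noteq> sin (2 * pi * t * y)"
  proof
    assume "sin (2 * pi * t * x) = sin (2 * pi * t * y)"
    then have "2 * pi * t * x = 2 * pi * t * y"
      using range xy by (metis sin_inj_pi)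
    then show False using xy r by (simp add: t_def)
  qed
  then show "\<exists>f. trig_poly (\<lambda>x. complex_of_real (f x)) \<and> f x \<noteq> f y"
    by (intro exI[of _ "\<lambda>x. sin (2 * pi * t * x)"]) (simp add: trig_poly_sin)
qed (use assms in \<open>auto simp: trig_poly.add trig_poly_mult\<close>)

lemma (in real_distribution) continuous_in_closed_subspace:
  assumes C: "L2_closed_subspace M C" and e: "\<And>t. exponential t \<in> C"
    and supp: "AE x in M. \<bar>x\<bar> \<le> r"
    and g: "continuous_on UNIV g" "\<And>x. \<bar>g x\<bar> \<le> b"
  shows "(\<lambda>x. complex_of_real (g x)) \<in> C"
proof (rule L2_closed_subspaceD(4)[OF C])
  have [measurable]: "g \<in> borel_measurable borel"
    by (rule borel_measurable_continuous_onI[OF g(1)])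
  show gL2: "(\<lambda>x. complex_of_real (g x)) \<in> L2_functions M"
    by (rule L2_functions_dominated[of _ _ "\<lambda>_. b"]) (use g(2) in auto)
  fix \<epsilon> :: real assume "\<epsilon> > 0"
  define \<delta> where "\<delta> = sqrt (\<epsilon> / 2)"
  have \<delta>: "\<delta> > 0" "\<delta>\<^sup>2 < \<epsilon>" using \<open>\<epsilon> > 0\<close> by (auto simp: \<delta>_def)
  obtain f where f: "trig_poly (\<lambda>x. complex_of_real (f x))" "\<And>x. x \<in> {-r..r} \<Longrightarrow> \<bar>g x - f x\<bar> < \<delta>"
    using trig_poly_uniform_approx[OF continuous_on_subset[OF g(1)] \<delta>(1), of r] by auto
  have fC: "(\<lambda>x. complex_of_real (f x)) \<in> C"
    by (rule trig_poly_in_closed_subspace[OF C e f(1)])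
  have "L2_dist2 M (\<lambda>x. complex_of_real (g x)) (\<lambda>x. complex_of_real (f x)) \<le> \<delta>\<^sup>2"
    unfolding L2_dist2_def
  proof (rule integral_le_const)
    show "integrable M (\<lambda>x. (norm (complex_of_real (g x) - complex_of_real (f x)))\<^sup>2)"
      by (intro L2_functionsD(2) L2_functions_diff gL2 L2_closed_subspaceD(1)[OF C fC])
    show "AE x in M. (norm (complex_of_real (g x) - complex_of_real (f x)))\<^sup>2 \<le> \<delta>\<^sup>2"
      using supp
    proof eventually_elim
      case (elim x)
      then have "\<bar>g x - f x\<bar> \<le> \<delta>" using f(2)[of x] by (auto simp: abs_le_iff)
      then show ?case
        by (simp only: of_real_diff[symmetric] norm_of_real) (intro power_mono, auto)
    qed
  qed
  then show "\<exists>h\<in>C. L2_dist2 M (\<lambda>x. complex_of_real (g x)) h < \<epsilon>"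
    using fC \<delta>(2) by force
qed

text \<open>Indicators of half-lines are pointwise limits of continuous functions, and the sets whose
  indicator lies in the subspace form a Dynkin class.\<close>

theorem (in real_distribution) exponentials_total:
  assumes C: "L2_closed_subspace M C" and e: "\<And>t. exponential t \<in> C"
    and supp: "AE x in M. \<bar>x\<bar> \<le> r"
  shows "C = L2_functions M"
proof (rule L2_functions_eq_closed_subspace[OF C])
  have one: "(\<lambda>_. 1) \<in> C" using e[of 0] by (simp add: exponential_def[abs_def])
  fix A assume "A \<in> sets M"
  then have A: "A \<in> sigma_sets UNIV (range (\<lambda>a::real. {..a}))"
    by (simp add: borel_eq_atMost)
  have "Int_stable (range (\<lambda>a::real. {..a}))" "range (\<lambda>a::real. {..a}) \<subseteq> Pow UNIV"
    by (auto simp: Int_stable_def)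
  from this A show "indicator A \<in> C"
  proof (induction rule: sigma_sets_induct_disjoint)
    case (basic A)
    then obtain a where A: "A = {..a}" by auto
    \<comment> \<open>equal to 1 up to \<open>a\<close> and, for positive \<open>n\<close>, to 0 from \<open>a + 1/n\<close> on\<close>
    define g where "g n x = max 0 (min 1 (1 - real n * (x - a)))" for n x
    have "(\<lambda>x. complex_of_real (g n x)) \<in> C" for n
      by (rule continuous_in_closed_subspace[OF C e supp, of _ 1])
        (auto simp: g_def intro!: continuous_intros)
    then show ?case
    proof (rule L2_closed_subspace_dominated_limit[OF C])
      fix x
      show "(\<lambda>n. complex_of_real (g n x)) \<longlonglongrightarrow> indicator A x"
      proof (cases "x \<le> a")
        case True
        then have "g n x = 1" for n by (auto simp: g_def mult_nonneg_nonpos)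
        then show ?thesis using True by (simp add: A)
      next
        case False
        obtain N where N: "real N * (x - a) > 1"
          using reals_Archimedean3[of "x - a"] False by auto
        have "g n x = 0" if "n \<ge> N" for n
        proof -
          have "real N * (x - a) \<le> real n * (x - a)" using that False by (intro mult_right_mono) auto
          then show ?thesis using N by (simp add: g_def)
        qed
        then have "\<forall>\<^sub>F n in sequentially. complex_of_real (g n x) = indicator A x"
          using False by (auto simp: A eventually_sequentially intro!: exI[of _ N])
        then show ?thesis by (rule tendsto_eventually)
      qed
      show "norm (complex_of_real (g n x)) \<le> 1" for n by (auto simp: g_def)
    qed (auto simp: A)
  next
    case empty
    show ?case using L2_closed_subspaceD(3)[OF C one, of 0] by (simp add: indicator_def)
  next
    case (compl A)
    have "(\<lambda>x. 1 + (- 1) * indicator A x) \<in> C"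
      by (intro L2_closed_subspaceD(2,3)[OF C] one compl(2))
    also have "(\<lambda>x. 1 + (- 1) * indicator A x) = (indicator (UNIV - A) :: real \<Rightarrow> complex)"
      by (auto simp: indicator_def)
    finally show ?case .
  next
    case (union A)
    have "(\<lambda>x. \<Sum>i<n. indicator (A i) x) \<in> C" for n
    proof (induction n)
      case 0
      show ?case using L2_closed_subspaceD(3)[OF C one, of 0] by simp
    next
      case (Suc n)
      then show ?case using union(3) L2_closed_subspaceD(2)[OF C] by simp
    qed
    moreover have "(\<Sum>i<n. indicator (A i) x) = (indicator (\<Union>i<n. A i) x :: complex)" for n x
      using union(1) by (subst indicator_UN_disjoint) (auto simp: disjoint_family_on_def)
    ultimately have "indicator (\<Union>i<n. A i) \<in> C" for n by simp
    then show ?case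
    proof (rule L2_closed_subspace_dominated_limit[OF C])
      show "indicator (\<Union>i. A i) \<in> borel_measurable M"
      proof (rule borel_measurable_indicator)
        have "A i \<in> sets borel" for i using union(2) by (auto simp: borel_eq_atMost)
        then show "(\<Union>i. A i) \<in> sets M" by simp
      qed
      show "(\<lambda>n. indicator (\<Union>i<n. A i) x) \<longlonglongrightarrow> (indicator (\<Union>i. A i) x :: complex)" for x
        by (rule LIMSEQ_indicator_UN)
      show "norm (indicator (\<Union>i<n. A i) x :: complex) \<le> 1" for n x
        by (auto simp: indicator_def)
    qed auto
  qed
qed

section \<open>A minimum principle\<close>

text \<open>So \<open>-1\<close> is a power of 4 modulo every power of 5. With \<open>a = 4 ^ (5 ^ k)\<close>, the induction step uses
  that the cofactor of \<open>a + 1\<close> in \<open>a ^ 5 + 1\<close> is divisible by 5 because \<open>a \<equiv> -1\<close> modulo 5.\<close>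

lemma power5_dvd_four_power: "(5::int) ^ Suc k dvd 4 ^ (5 ^ k) + 1"
proof (induction k)
  case (Suc k)
  define a :: int where "a = 4 ^ (5 ^ k)"
  have a: "5 ^ Suc k dvd a + 1" using Suc.IH by (simp add: a_def)
  then obtain b where b: "a + 1 = 5 * b"
    by (metis dvd_def mult.assoc power_Suc)
  then have "a ^ 4 - a ^ 3 + a ^ 2 - a + 1 = 5 * (125 * b^4 - 125 * b^3 + 50 * b^2 - 10 * b + 1)"
  proof -
    have a_eq: "a = 5 * b - 1" using b by simp
    show ?thesis
      unfolding a_eq by (simp add: power4_eq_xxxx power3_eq_cube power2_eq_square algebra_simps)
  qed
  then have "5 dvd a ^ 4 - a ^ 3 + a ^ 2 - a + 1" by (metis dvd_triv_left)
  with a have "5 ^ Suc k * 5 dvd (a + 1) * (a ^ 4 - a ^ 3 + a ^ 2 - a + 1)"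
    by (rule mult_dvd_mono)
  also have "(a + 1) * (a ^ 4 - a ^ 3 + a ^ 2 - a + 1) = a ^ 5 + 1"
    by (simp add: algebra_simps power_numeral_reduce)
  also have "a ^ 5 = 4 ^ (5 ^ Suc k)"
    by (simp add: a_def power_mult[symmetric] mult.commute)
  finally show ?case by (simp add: mult.commute)
qed simp

text \<open>Every integer orbit of the maps \<open>x \<mapsto> x/4\<close> and \<open>x \<mapsto> (x - 5 ^ k)/4\<close> reaches 0; in particular
  these maps have no nonzero integer cycle.\<close>

lemma integer_orbit_hits_zero:
  fixes x :: "nat \<Rightarrow> int"
  assumes step: "\<And>n. \<exists>d\<in>{0, 1}. 4 * x (Suc n) = x n - d * 5 ^ k"
  shows "\<exists>n. x n = 0"
proof -
  define L :: int where "L = 5 ^ k"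
  have L: "L \<ge> 1" by (simp add: L_def)
  have dvd: "L dvd 4 ^ m * x (n + m) - x n" for n m
  proof (induction m)
    case (Suc m)
    obtain d where d: "4 * x (Suc (n + m)) = x (n + m) - d * L"
      using step[of "n + m"] by (auto simp: L_def)
    have "4 ^ Suc m * x (n + Suc m) - x n = 4 ^ m * (4 * x (Suc (n + m))) - x n"
      by simp
    also have "\<dots> = (4 ^ m * x (n + m) - x n) - 4 ^ m * d * L"
      by (simp only: d) (simp add: algebra_simps)
    finally show ?case using Suc.IH by (simp only: dvd_diff dvd_triv_right)
  qed simp
  define N where "N = (5::nat) ^ k"
  have sum_dvd: "L dvd x n + x (n + N)" for n
  proof -
    have "L dvd 4 ^ N + 1"
      using power5_dvd_four_power[of k] by (auto simp: L_def N_def elim: dvd_mult_right)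
    then have "L dvd (4 ^ N + 1) * x (n + N) - (4 ^ N * x (n + N) - x n)"
      using dvd[of N n] by (rule dvd_diff[OF dvd_mult2])
    then show ?thesis by (simp add: algebra_simps)
  qed
  \<comment> \<open>the maps contract by 1/4 towards the interval from \<open>-L/3\<close> to 0\<close>
  define A where "A = 3 * \<bar>x 0\<bar>"
  have bounds: "4 ^ n * x n \<le> A \<and> - A \<le> 4 ^ n * (3 * x n + L)" for n
  proof (induction n)
    case 0
    show ?case using L by (auto simp: A_def)
  next
    case (Suc n)
    obtain d where d: "d \<in> {0, 1}" "4 * x (Suc n) = x n - d * L"
      using step[of n] by (auto simp: L_def)
    have "4 ^ Suc n * x (Suc n) = 4 ^ n * (4 * x (Suc n))" by simp
    also have "\<dots> \<le> 4 ^ n * x n" using d L by (auto intro!: mult_left_mono)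
    finally have 1: "4 ^ Suc n * x (Suc n) \<le> A" using Suc by linarith
    have "4 ^ Suc n * (3 * x (Suc n) + L) = 4 ^ n * (3 * (4 * x (Suc n)) + 4 * L)"
      by (simp add: algebra_simps)
    also have "\<dots> \<ge> 4 ^ n * (3 * x n + L)" using d L by (auto intro!: mult_left_mono)
    finally have 2: "- A \<le> 4 ^ Suc n * (3 * x (Suc n) + L)" using Suc by linarith
    from 1 2 show ?case ..
  qed
  obtain n where "real_of_int A < 4 ^ n"
    using real_arch_pow[of 4 "real_of_int A"] by auto
  then have n: "A < 4 ^ n" by (metis of_int_less_iff of_int_numeral of_int_power)
  have range: "x m \<le> 0 \<and> 0 \<le> 3 * x m + L" if "m \<ge> n" for m
  proof -
    have lt: "A < 4 ^ m" using n power_increasing[OF that, of "4::int"] by linarith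
    have "\<not> x m \<ge> 1"
    proof
      assume "x m \<ge> 1"
      then have "4 ^ m * 1 \<le> 4 ^ m * x m" by (intro mult_left_mono) auto
      then show False using bounds[of m] lt by linarith
    qed
    moreover have "\<not> 3 * x m + L \<le> -1"
    proof
      assume "3 * x m + L \<le> -1"
      then have "4 ^ m * (3 * x m + L) \<le> 4 ^ m * (-1)" by (intro mult_left_mono) auto
      then show False using bounds[of m] lt by linarith
    qed
    ultimately show ?thesis by linarith
  qed
  have r: "x n \<le> 0" "x (n + N) \<le> 0" "\<bar>x n + x (n + N)\<bar> < \<bar>L\<bar>"
    using range[of n] range[of "n + N"] L by auto
  have "x n + x (n + N) = 0"
    using dvd_imp_le_int[OF _ sum_dvd[of n]] r(3) by fastforce
  with r have "x n = 0" by linarith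
  then show ?thesis ..
qed

lemma lower_semicontinuous_attains_inf:
  fixes f :: "'a::topological_space \<Rightarrow> real"
  assumes "compact K" "K \<noteq> {}"
    and lsc: "\<And>c. open {x. c < f x}"
  shows "\<exists>x\<in>K. \<forall>y\<in>K. f x \<le> f y"
proof (rule ccontr)
  assume no: "\<not> ?thesis"
  have *: "\<exists>y\<in>K. f y < f x" if "x \<in> K" for x using no that by (meson not_le)
  have "K \<subseteq> (\<Union>y\<in>K. {x. f y < f x})" using * by auto
  then obtain Y where Y: "Y \<subseteq> K" "finite Y" "K \<subseteq> (\<Union>y\<in>Y. {x. f y < f x})"
    using compactE_image[OF assms(1), of K "\<lambda>y. {x. f y < f x}"] lsc by metis
  have "Y \<noteq> {}" using Y assms(2) by auto
  then have "Min (f ` Y) \<in> f ` Y" using Y(2) by (intro Min_in) auto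
  then obtain y where y: "y \<in> Y" "Min (f ` Y) = f y" by auto
  then obtain z where "z \<in> Y" "f z < f y" using Y(1,3) by auto
  moreover have "Min (f ` Y) \<le> f z" using Y(2) \<open>z \<in> Y\<close> by (intro Min_le) auto
  ultimately show False using y by simp
qed

lemma cos_sin_half_pi_of_int:
  "even n \<Longrightarrow> (cos (pi * real_of_int n / 2))\<^sup>2 = 1"
  "odd n \<Longrightarrow> (cos (pi * real_of_int n / 2))\<^sup>2 = 0"
proof -
  have "cos (pi * real_of_int m) = cos (2 * (pi * real_of_int m / 2))" for m by simp
  then have c: "(cos (pi * real_of_int m / 2))\<^sup>2 = (1 + cos (pi * real_of_int m)) / 2" for m
    using cos_double_cos[of "pi * real_of_int m / 2"] by simp
  show "(cos (pi * real_of_int n / 2))\<^sup>2 = 1" if "even n"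
    using that by (simp add: c cos_npi_int mult.commute)
  show "(cos (pi * real_of_int n / 2))\<^sup>2 = 0" if "odd n"
    using that by (simp add: c cos_npi_int mult.commute)
qed

lemma Ints_if_cos_or_sin_zero:
  assumes "(cos (pi * x / 2))\<^sup>2 = 0 \<or> (sin (pi * x / 2))\<^sup>2 = 0"
  shows "x \<in> \<int>"
proof -
  from assms consider "cos (pi * x / 2) = 0" | "sin (pi * x / 2) = 0" by auto
  then show ?thesis
  proof cases
    case 1
    then obtain i :: int where "odd i" "pi * x / 2 = of_int i * (pi / 2)"
      by (auto simp: cos_zero_iff_int)
    then show ?thesis by simp
  next
    case 2
    then obtain i :: int where "pi * x / 2 = of_int i * pi"
      by (auto simp: sin_zero_iff_int2)
    then have "x = of_int (2 * i)" by simp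
    then show ?thesis by (metis Ints_of_int)
  qed
qed

text \<open>The minimum principle for the transfer operator with weights \<open>cos\<^sup>2(\<pi>t/2)\<close> and \<open>sin\<^sup>2(\<pi>t/2)\<close>.
  The weights vanish only at integers, and at each integer exactly one of them does.\<close>

lemma harmonic_ge_one:
  fixes h :: "real \<Rightarrow> real"
  assumes eq: "\<And>t. h t = (cos (pi * t / 2))\<^sup>2 * h (t / 4) + (sin (pi * t / 2))\<^sup>2 * h ((t - 5 ^ k) / 4)"
    and lsc: "\<And>c. open {t. c < h t}"
    and h0: "h 0 = 1"
  shows "1 \<le> h t"
proof -
  define A where "A = max \<bar>t\<bar> (5 ^ k)"
  have A: "5 ^ k \<le> A" "0 < (5::real) ^ k" by (auto simp: A_def)
  have inv: "x / 4 \<in> {-A..A}" "(x - 5 ^ k) / 4 \<in> {-A..A}" if "x \<in> {-A..A}" for x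
  proof -
    have "-A \<le> x" "x \<le> A" using that by auto
    then have "-A \<le> x / 4" "x / 4 \<le> A" "-A \<le> (x - L) / 4" "(x - L) / 4 \<le> A"
      if "L \<le> A" "0 < L" for L
      using that by (simp_all add: field_simps)
    from this[OF A] show "x / 4 \<in> {-A..A}" "(x - 5 ^ k) / 4 \<in> {-A..A}" by auto
  qed
  have "0 \<in> {-A..A}" "t \<in> {-A..A}" by (auto simp: A_def)
  have "\<exists>x\<in>{-A..A}. \<forall>y\<in>{-A..A}. h x \<le> h y"
    by (rule lower_semicontinuous_attains_inf)
      (use \<open>0 \<in> _\<close> lsc in auto)
  then obtain x0 where x0: "x0 \<in> {-A..A}" "\<And>y. y \<in> {-A..A} \<Longrightarrow> h x0 \<le> h y" by auto
  define M where "M = {x\<in>{-A..A}. h x = h x0}"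
  have "x0 \<in> M" using x0 by (auto simp: M_def)
  have M: "((cos (pi * x / 2))\<^sup>2 \<noteq> 0 \<longrightarrow> x / 4 \<in> M) \<and> ((sin (pi * x / 2))\<^sup>2 \<noteq> 0 \<longrightarrow> (x - 5 ^ k) / 4 \<in> M)"
    if "x \<in> M" for x
  proof -
    let ?c = "(cos (pi * x / 2))\<^sup>2" and ?s = "(sin (pi * x / 2))\<^sup>2"
    have x: "x \<in> {-A..A}" "h x = h x0" using that by (auto simp: M_def)
    have ge: "h x0 \<le> h (x / 4)" "h x0 \<le> h ((x - 5 ^ k) / 4)"
      using x0(2)[OF inv(1)[OF x(1)]] x0(2)[OF inv(2)[OF x(1)]] .
    have "?c * (h (x / 4) - h x0) + ?s * (h ((x - 5 ^ k) / 4) - h x0)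
        = (?c * h (x / 4) + ?s * h ((x - 5 ^ k) / 4)) - (?c * h x0 + ?s * h x0)"
      by (simp only: right_diff_distrib)
    also have "?c * h x0 + ?s * h x0 = h x0"
      by (simp only: distrib_right[symmetric] sin_cos_squared_add2 mult_1)
    also have "?c * h (x / 4) + ?s * h ((x - 5 ^ k) / 4) = h x0" using eq[of x] x(2) by simp
    also have "h x0 - h x0 = 0" by simp
    finally have z: "?c * (h (x / 4) - h x0) = 0" "?s * (h ((x - 5 ^ k) / 4) - h x0) = 0"
      using ge by (auto simp: add_nonneg_eq_0_iff)
    show ?thesis using z inv[OF x(1)] by (auto simp: M_def)
  qed
  have "h 0 \<le> h x0"
  proof (cases "M \<subseteq> \<int>")
    case False
    then obtain x where x: "x \<in> M" "x \<notin> \<int>" by auto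
    have "x / 4 ^ n \<in> M \<and> x / 4 ^ n \<notin> \<int>" for n
    proof (induction n)
      case (Suc n)
      let ?y = "x / 4 ^ n"
      have "?y / 4 \<in> M" using M[of ?y] Suc Ints_if_cos_or_sin_zero[of ?y] by blast
      moreover have "?y / 4 \<notin> \<int>"
      proof
        assume "?y / 4 \<in> \<int>"
        then have "4 * (?y / 4) \<in> \<int>" by (intro Ints_mult) auto
        then show False using Suc by simp
      qed
      ultimately show ?case by (simp add: mult.commute)
    qed (use x in simp)
    then have c: "h (x / 4 ^ n) = h x0" for n by (auto simp: M_def)
    show ?thesis
    proof (rule ccontr)
      assume "\<not> ?thesis"
      then have "0 \<in> {t. h x0 < h t}" by simp
      moreover have "(\<lambda>n. x / 4 ^ n) \<longlonglongrightarrow> 0" by (rule LIMSEQ_divide_realpow_zero) simp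
      ultimately have "\<forall>\<^sub>F n in sequentially. x / 4 ^ n \<in> {t. h x0 < h t}"
        using lsc topological_tendstoD by blast
      then show False using c by simp
    qed
  next
    case True
    \<comment> \<open>the image of an integer under the branch of weight 1; the division is exact on minimizers\<close>
    define next_pt where "next_pt y = (if even y then y div 4 else (y - 5 ^ k) div 4)" for y :: int
    have next_pt: "real_of_int (next_pt y) \<in> M \<and> (\<exists>d\<in>{0, 1}. 4 * next_pt y = y - d * 5 ^ k)"
      if "real_of_int y \<in> M" for y
    proof -
      define d :: int where "d = (if even y then 0 else 1)"
      have "(sin (pi * real_of_int y / 2))\<^sup>2 = 1" if "odd y"
        using cos_sin_half_pi_of_int(2)[OF that] sin_cos_squared_add2[of "pi * real_of_int y / 2"]
        by simp
      then have m: "real_of_int (y - d * 5 ^ k) / 4 \<in> M"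
        using M[OF that] cos_sin_half_pi_of_int(1)[of y] by (auto simp: d_def)
      then have "real_of_int (y - d * 5 ^ k) / 4 \<in> \<int>" using True by auto
      then obtain z where z: "real_of_int (y - d * 5 ^ k) / 4 = real_of_int z"
        by (auto elim: Ints_cases)
      then have "real_of_int (y - d * 5 ^ k) = real_of_int (4 * z)" by simp
      then have z4: "y - d * 5 ^ k = 4 * z" by (simp only: of_int_eq_iff)
      have "next_pt y = (y - d * 5 ^ k) div 4" by (simp add: next_pt_def d_def)
      then have "next_pt y = z" using z4 by simp
      then show ?thesis using m z z4 by (auto simp: d_def split: if_splits)
    qed
    obtain y0 where y0: "x0 = real_of_int y0" using \<open>x0 \<in> M\<close> True by (auto elim: Ints_cases)
    define x where "x n = (next_pt ^^ n) y0" for n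
    have xM: "real_of_int (x n) \<in> M" for n
      by (induction n) (use \<open>x0 \<in> M\<close> y0 next_pt in \<open>auto simp: x_def\<close>)
    have "\<exists>n. x n = 0"
      by (rule integer_orbit_hits_zero[of _ k]) (use next_pt[OF xM] in \<open>auto simp: x_def\<close>)
    then have "0 \<in> M" using xM by (metis of_int_0)
    then show ?thesis by (simp add: M_def)
  qed
  then show ?thesis using h0 x0(2)[OF \<open>t \<in> _\<close>] by simp
qed

section \<open>The Fourier transform of the measure\<close>

interpretation mu_B: real_distribution mu_B
  by (rule mu_B_invariant_real_distribution[OF mu_B_invariant_mu_B])

text \<open>Invariance bounds the mass of each of the intervals \<open>[-4 ^ n, 1 + 4 ^ n]\<close> by that of the preceding
  one, so all of them have full mass.\<close>

lemma mu_B_bounded_support: "AE x in mu_B. \<bar>x\<bar> \<le> 2"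
proof -
  define J where "J n = {- (4 ^ n) .. 1 + 4 ^ n :: real}" for n :: nat
  have J_step: "measure mu_B (J (Suc n)) \<le> measure mu_B (J n)" for n
  proof -
    have "J (Suc n) \<subseteq> tau b -` J n" if "b = 0 \<or> b = 2" for b
    proof -
      have "(1::real) \<le> 4 ^ n" by simp
      then show ?thesis using that by (auto simp: J_def tau_def field_simps)
    qed
    then have "measure mu_B (J (Suc n)) \<le> measure mu_B (tau b -` J n)" if "b = 0 \<or> b = 2" for b
    proof (rule mu_B.finite_measure_mono)
      show "tau b -` J n \<in> sets mu_B"
        using measurable_sets[OF tau_measurable, of "J n" b] by (simp add: J_def)
    qed (use that in auto)
    from this[of 0] this[of 2]
    have "measure mu_B (J (Suc n)) \<le> (measure mu_B (tau 0 -` J n) + measure mu_B (tau 2 -` J n)) / 2"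
      by simp
    also have "\<dots> = measure mu_B (J n)"
      using mu_B_invariant_mu_B by (simp add: mu_B_invariant_def J_def)
    finally show ?thesis .
  qed
  have J_le: "measure mu_B (J n) \<le> measure mu_B (J 0)" for n
    by (induction n) (auto intro: order_trans[OF J_step])
  have "range J \<subseteq> sets mu_B" by (auto simp: J_def)
  moreover have "incseq J"
    unfolding incseq_Suc_iff by (auto simp: J_def intro: order_trans)
  ultimately have "(\<lambda>n. measure mu_B (J n)) \<longlonglongrightarrow> measure mu_B (\<Union>n. J n)"
    by (rule mu_B.finite_Lim_measure_incseq)
  also have "(\<Union>n. J n) = UNIV"
  proof -
    have "\<exists>n. x \<in> J n" for x
    proof -
      obtain n where "\<bar>x\<bar> < 4 ^ n" using real_arch_pow[of 4 "\<bar>x\<bar>"] by auto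
      then show ?thesis by (intro exI[of _ n]) (auto simp: J_def)
    qed
    then show ?thesis by auto
  qed
  also have "measure mu_B UNIV = 1" using mu_B.prob_space by simp
  finally have "1 \<le> measure mu_B (J 0)"
    by (rule LIMSEQ_le_const2) (use J_le in auto)
  then have "measure mu_B (J 0) = 1" using mu_B.prob_le_1[of "J 0"] by linarith
  then have "AE x in mu_B. x \<in> J 0" by (subst mu_B.AE_in_set_eq_1) (auto simp: J_def)
  then show ?thesis by eventually_elim (auto simp: J_def)
qed

text \<open>The squared modulus of the Fourier transform of the measure at frequency \<open>t\<close>, normalised so that
  \<open>t\<close> is the frequency of \<open>exponential t\<close>.\<close>

definition power_mu_B :: "real \<Rightarrow> real"
  where "power_mu_B t = (norm (char mu_B (2 * pi * t)))\<^sup>2"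

lemma L2_inner_exponential_mu_B:
  "L2_inner mu_B (exponential s) (exponential t) = char mu_B (2 * pi * (s - t))"
proof -
  have "exponential s x * cnj (exponential t x) = iexp (2 * pi * (s - t) * x)" for x
    by (simp add: cnj_exponential exponential_mult) (simp add: exponential_def algebra_simps)
  then show ?thesis by (simp add: L2_inner_def char_def)
qed

lemma power_mu_B_0 [simp]: "power_mu_B 0 = 1"
  by (simp add: power_mu_B_def mu_B.char_zero)

lemma power_mu_B_nonneg: "0 \<le> power_mu_B t"
  by (simp add: power_mu_B_def)

lemma continuous_power_mu_B: "continuous_on S power_mu_B"
proof -
  have "continuous_on UNIV (char mu_B)"
    by (auto intro: continuous_at_imp_continuous_on mu_B.isCont_char)
  then have "continuous_on S (\<lambda>t. char mu_B (2 * pi * t))"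
    by (rule continuous_on_compose2) (auto intro!: continuous_intros)
  then show ?thesis
    unfolding power_mu_B_def[abs_def] by (intro continuous_intros)
qed

lemma power_mu_B_scaling: "power_mu_B t = (cos (pi * t / 2))\<^sup>2 * power_mu_B (t / 4)"
proof -
  have "norm ((1 + iexp (2 * \<theta>)) / 2) = \<bar>cos \<theta>\<bar>" for \<theta> :: real
  proof -
    have "iexp (2 * \<theta>) = iexp \<theta> * iexp \<theta>" by (simp add: exp_add[symmetric] algebra_simps)
    moreover have "iexp \<theta> * iexp (- \<theta>) = 1" by (simp add: exp_add[symmetric])
    ultimately have "(1 + iexp (2 * \<theta>)) / 2 = iexp \<theta> * ((iexp \<theta> + iexp (- \<theta>)) / 2)"
      by (simp add: algebra_simps)
    also have "(iexp \<theta> + iexp (- \<theta>)) / 2 = complex_of_real (cos \<theta>)"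
      by (simp add: cos_exp_eq cos_of_real[symmetric])
    finally show ?thesis by (simp add: norm_mult)
  qed
  from this[of "pi * t / 2"]
  have "norm ((1 + iexp (2 * pi * t / 2)) / 2) = \<bar>cos (pi * t / 2)\<bar>" by simp
  then show ?thesis
    unfolding power_mu_B_def
    by (subst mu_B_invariant_char[OF mu_B_invariant_mu_B])
      (simp only: norm_mult power_mult_distrib power2_abs times_divide_eq_right)
qed

section \<open>Orthonormality\<close>

text \<open>The sums \<open>\<Sum>j<n. 4 ^ j * l j\<close> with digits \<open>l j \<in> {0, L}\<close>. They are built from the least significant
  digit, matching the functional equation of \<open>power_mu_B\<close>. The levels increase with \<open>n\<close>, and
  their union is \<open>Gamma_set {0, L}\<close>; a sum with top index \<open>n\<close> belongs to level \<open>Suc n\<close>.\<close>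

fun spectrum_level :: "int \<Rightarrow> nat \<Rightarrow> int set" where
  "spectrum_level L 0 = {0}"
| "spectrum_level L (Suc n) = (\<lambda>g. 4 * g) ` spectrum_level L n \<union> (\<lambda>g. 4 * g + L) ` spectrum_level L n"

lemma finite_spectrum_level [simp]: "finite (spectrum_level L n)"
  by (induction n) auto

lemma spectrum_level_mono: "m \<le> n \<Longrightarrow> spectrum_level L m \<subseteq> spectrum_level L n"
proof (rule lift_Suc_mono_le[of "spectrum_level L"])
  show "spectrum_level L n \<subseteq> spectrum_level L (Suc n)" for n
    by (induction n) auto
qed

lemma spectrum_level_Suc_eq_sums:
  "real_of_int ` spectrum_level L (Suc n)
    = {(\<Sum>j\<le>n. 4 ^ j * l j) | l. \<forall>j\<le>n. l j \<in> {0, real_of_int L}}"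
proof (induction n)
  case 0
  have "\<exists>l. a = l 0 \<and> (l 0 = 0 \<or> l 0 = b)" if "a = 0 \<or> a = b" for a b :: real
    using that by (intro exI[of _ "\<lambda>_. a"]) auto
  then show ?case by auto
next
  case (Suc n)
  let ?S = "\<lambda>n. {(\<Sum>j\<le>n. 4 ^ j * l j) | l. \<forall>j\<le>n. l j \<in> {0, real_of_int L}}"
  have "real_of_int ` spectrum_level L (Suc (Suc n))
      = (\<lambda>x. 4 * x) ` (real_of_int ` spectrum_level L (Suc n))
        \<union> (\<lambda>x. 4 * x + real_of_int L) ` (real_of_int ` spectrum_level L (Suc n))"
    by (simp only: spectrum_level.simps(2)[of L "Suc n"] image_Un image_image) simp
  also have "\<dots> = (\<lambda>x. 4 * x) ` ?S n \<union> (\<lambda>x. 4 * x + real_of_int L) ` ?S n"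
    by (simp only: Suc.IH)
  also have "\<dots> = ?S (Suc n)"
  proof -
    have split: "(\<Sum>j\<le>Suc n. 4 ^ j * l j) = 4 * (\<Sum>j\<le>n. 4 ^ j * l (Suc j)) + l 0" for l :: "nat \<Rightarrow> real"
      by (subst sum.atMost_Suc_shift) (simp add: sum_distrib_left mult.assoc)
    show ?thesis
    proof (intro equalityI subsetI)
      fix x assume "x \<in> (\<lambda>x. 4 * x) ` ?S n \<union> (\<lambda>x. 4 * x + real_of_int L) ` ?S n"
      then obtain l d where l: "\<forall>j\<le>n. l j \<in> {0, real_of_int L}" "d \<in> {0, real_of_int L}"
          "x = 4 * (\<Sum>j\<le>n. 4 ^ j * l j) + d"
        by fastforce
      then show "x \<in> ?S (Suc n)"
        by (intro CollectI exI[of _ "case_nat d l"]) (auto simp: split simp del: sum.atMost_Suc split: nat.split)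
    next
      fix x assume "x \<in> ?S (Suc n)"
      then obtain l where l: "\<forall>j\<le>Suc n. l j \<in> {0, real_of_int L}" "x = (\<Sum>j\<le>Suc n. 4 ^ j * l j)"
        by blast
      then have "(\<Sum>j\<le>n. 4 ^ j * l (Suc j)) \<in> ?S n"
        by (intro CollectI exI[of _ "\<lambda>j. l (Suc j)"]) auto
      moreover have "l 0 = 0 \<or> l 0 = real_of_int L" using l by auto
      ultimately show "x \<in> (\<lambda>x. 4 * x) ` ?S n \<union> (\<lambda>x. 4 * x + real_of_int L) ` ?S n"
        unfolding l(2) split by (auto simp del: sum.atMost_Suc)
    qed
  qed
  finally show ?case .
qed

lemma Gamma_set_eq_Union:
  "Gamma_set {0, real_of_int L} = (\<Union>n. real_of_int ` spectrum_level L n)"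
proof -
  have "Gamma_set {0, real_of_int L} = (\<Union>n. real_of_int ` spectrum_level L (Suc n))"
    unfolding spectrum_level_Suc_eq_sums Gamma_set_def by auto
  also have "\<dots> = (\<Union>n. real_of_int ` spectrum_level L n)"
    using spectrum_level_mono[OF le_SucI[OF order_refl]] by (force simp del: spectrum_level.simps)
  finally show ?thesis .
qed

lemma power_mu_B_spectrum_diff:
  assumes "odd L" "g \<in> spectrum_level L n" "h \<in> spectrum_level L n" "g \<noteq> h"
  shows "power_mu_B (real_of_int (g - h)) = 0"
  using assms(2-)
proof (induction n arbitrary: g h)
  case (Suc n)
  have sc: "power_mu_B (real_of_int m) = (cos (pi * real_of_int m / 2))\<^sup>2 * power_mu_B (real_of_int m / 4)" for m
    by (rule power_mu_B_scaling)
  have digit: "\<exists>a r. a \<in> spectrum_level L n \<and> (r = 0 \<or> r = L) \<and> m = 4 * a + r"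
    if "m \<in> spectrum_level L (Suc n)" for m
  proof -
    from that consider a where "a \<in> spectrum_level L n" "m = 4 * a"
      | a where "a \<in> spectrum_level L n" "m = 4 * a + L" by auto
    then show ?thesis by cases force+
  qed
  obtain a r where a: "a \<in> spectrum_level L n" "r = 0 \<or> r = L" "g = 4 * a + r"
    using digit[OF Suc.prems(1)] by blast
  obtain b s where b: "b \<in> spectrum_level L n" "s = 0 \<or> s = L" "h = 4 * b + s"
    using digit[OF Suc.prems(2)] by blast
  show ?case
  proof (cases "r = s")
    case True
    then have "a \<noteq> b" "real_of_int (g - h) / 4 = real_of_int (a - b)"
      using Suc.prems(3) a(3) b(3) by auto
    then show ?thesis using Suc.IH[OF a(1) b(1) \<open>a \<noteq> b\<close>]
      by (subst sc) (simp only: mult_zero_right)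
  next
    case False
    then have "odd (g - h)" using a b assms(1) by auto
    then have "(cos (pi * real_of_int (g - h) / 2))\<^sup>2 = 0" by (rule cos_sin_half_pi_of_int(2))
    then show ?thesis by (subst sc) (simp only: mult_zero_left)
  qed
qed simp

lemma Gamma_set_orthonormal:
  assumes "odd L" "g \<in> Gamma_set {0, real_of_int L}" "h \<in> Gamma_set {0, real_of_int L}"
  shows "L2_inner mu_B (exponential g) (exponential h) = (if g = h then 1 else 0)"
proof (cases "g = h")
  case True
  then show ?thesis by (simp add: L2_inner_exponential_mu_B mu_B.char_zero)
next
  case False
  obtain m n a b where a: "a \<in> spectrum_level L m" "g = real_of_int a"
      and b: "b \<in> spectrum_level L n" "h = real_of_int b"
    using assms(2,3) unfolding Gamma_set_eq_Union by auto
  have "a \<in> spectrum_level L (max m n)" "b \<in> spectrum_level L (max m n)"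
    using a b spectrum_level_mono[of m "max m n" L] spectrum_level_mono[of n "max m n" L] by auto
  then have "power_mu_B (g - h) = 0"
    using power_mu_B_spectrum_diff[OF assms(1)] a b False by force
  then show ?thesis using False by (simp add: L2_inner_exponential_mu_B power_mu_B_def)
qed

section \<open>Completeness\<close>

text \<open>The distance from an exponential to the span of a finite orthonormal family of exponentials;
  that it is nonnegative is Bessel's inequality.\<close>

lemma (in real_distribution) L2_dist2_exponential_projection:
  assumes fin: "finite F"
    and on: "\<And>i j. i \<in> F \<Longrightarrow> j \<in> F \<Longrightarrow> L2_inner M (exponential i) (exponential j) = (if i = j then 1 else 0)"
  shows "L2_dist2 M (exponential t) (\<lambda>x. \<Sum>i\<in>F. L2_inner M (exponential t) (exponential i) * exponential i x)
    = 1 - (\<Sum>i\<in>F. (norm (L2_inner M (exponential t) (exponential i)))\<^sup>2)"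
proof -
  define c where "c i = L2_inner M (exponential t) (exponential i)" for i
  define \<phi> where "\<phi> s = (\<integral>x. exponential s x \<partial>M)" for s
  have int [simp]: "integrable M (exponential s)" for s
    by (rule integrable_const_bound[where B = 1]) auto
  have inner: "L2_inner M (exponential s) (exponential u) = \<phi> (s - u)" for s u
    by (simp add: L2_inner_def cnj_exponential exponential_mult \<phi>_def)
  have \<phi>_minus: "\<phi> (- s) = cnj (\<phi> s)" for s
    by (simp add: \<phi>_def cnj_exponential[symmetric] Bochner_Integration.integral_cnj)
  have \<phi>0: "\<phi> 0 = 1" using prob_space by (simp add: \<phi>_def)
  have expand: "complex_of_real ((norm (exponential t x - (\<Sum>i\<in>F. c i * exponential i x)))\<^sup>2)
      = 1 - (\<Sum>i\<in>F. cnj (c i) * exponential (t - i) x) - (\<Sum>i\<in>F. c i * exponential (i - t) x)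
        + (\<Sum>i\<in>F. \<Sum>j\<in>F. c i * cnj (c j) * exponential (i - j) x)" for x
  proof -
    have cnj: "cnj (exponential t x - (\<Sum>i\<in>F. c i * exponential i x))
        = exponential (- t) x - (\<Sum>i\<in>F. cnj (c i) * exponential (- i) x)"
      by (simp add: cnj_sum cnj_exponential)
    have "(\<Sum>i\<in>F. c i * exponential i x) * (\<Sum>j\<in>F. cnj (c j) * exponential (- j) x)
        = (\<Sum>i\<in>F. \<Sum>j\<in>F. c i * cnj (c j) * exponential (i - j) x)"
      unfolding sum_product
    proof (intro sum.cong refl)
      fix i j
      have "exponential (i - j) x = exponential i x * exponential (- j) x"
        by (simp add: exponential_mult)
      then show "c i * exponential i x * (cnj (c j) * exponential (- j) x)
          = c i * cnj (c j) * exponential (i - j) x" by (simp add: mult_ac)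
    qed
    moreover have "exponential t x * (\<Sum>i\<in>F. cnj (c i) * exponential (- i) x)
        = (\<Sum>i\<in>F. cnj (c i) * exponential (t - i) x)"
      by (simp add: sum_distrib_left exponential_mult mult.left_commute)
    moreover have "(\<Sum>i\<in>F. c i * exponential i x) * exponential (- t) x
        = (\<Sum>i\<in>F. c i * exponential (i - t) x)"
      by (simp add: sum_distrib_right exponential_mult mult.assoc)
    ultimately show ?thesis
      unfolding complex_norm_square cnj
      by (simp add: left_diff_distrib right_diff_distrib exponential_mult)
  qed
  have "complex_of_real (L2_dist2 M (exponential t) (\<lambda>x. \<Sum>i\<in>F. c i * exponential i x))
      = (\<integral>x. 1 - (\<Sum>i\<in>F. cnj (c i) * exponential (t - i) x) - (\<Sum>i\<in>F. c i * exponential (i - t) x)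
        + (\<Sum>i\<in>F. \<Sum>j\<in>F. c i * cnj (c j) * exponential (i - j) x) \<partial>M)"
    by (simp only: L2_dist2_def integral_complex_of_real[symmetric] expand)
  also have "\<dots> = 1 - (\<Sum>i\<in>F. cnj (c i) * \<phi> (t - i)) - (\<Sum>i\<in>F. c i * \<phi> (i - t))
        + (\<Sum>i\<in>F. \<Sum>j\<in>F. c i * cnj (c j) * \<phi> (i - j))"
    using prob_space by (simp add: \<phi>_def)
  also have "(\<Sum>i\<in>F. cnj (c i) * \<phi> (t - i)) = (\<Sum>i\<in>F. c i * cnj (c i))"
    by (simp add: c_def inner mult.commute)
  also have "(\<Sum>i\<in>F. c i * \<phi> (i - t)) = (\<Sum>i\<in>F. c i * cnj (c i))"
    using \<phi>_minus[of "t - _"] by (simp add: c_def inner)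
  also have "(\<Sum>i\<in>F. \<Sum>j\<in>F. c i * cnj (c j) * \<phi> (i - j)) = (\<Sum>i\<in>F. \<Sum>j\<in>F. if j = i then c i * cnj (c i) else 0)"
    using on by (intro sum.cong refl) (auto simp: inner[symmetric])
  also have "\<dots> = (\<Sum>i\<in>F. c i * cnj (c i))" using fin by simp
  finally have "complex_of_real (L2_dist2 M (exponential t) (\<lambda>x. \<Sum>i\<in>F. c i * exponential i x))
      = complex_of_real (1 - (\<Sum>i\<in>F. (norm (c i))\<^sup>2))"
    by (simp add: complex_norm_square[symmetric])
  then show ?thesis unfolding of_real_eq_iff c_def .
qed

text \<open>The sum of the squared moduli of the Fourier coefficients of \<open>exponential t\<close> over the frequencies
  in level \<open>n\<close>.\<close>

definition level_sum :: "int \<Rightarrow> nat \<Rightarrow> real \<Rightarrow> real"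
  where "level_sum L n t = (\<Sum>g\<in>spectrum_level L n. power_mu_B (t - real_of_int g))"

lemma level_sum_0: "level_sum L 0 t = power_mu_B t"
  by (simp add: level_sum_def)

lemma level_sum_mono: "m \<le> n \<Longrightarrow> level_sum L m t \<le> level_sum L n t"
  unfolding level_sum_def by (intro sum_mono2 spectrum_level_mono) (auto simp: power_mu_B_nonneg)

lemma continuous_level_sum: "continuous_on S (level_sum L n)"
  unfolding level_sum_def[abs_def]
  by (intro continuous_on_sum continuous_on_compose2[OF continuous_power_mu_B[of UNIV]])
    (auto intro!: continuous_intros)

lemma level_sum_Suc:
  assumes "odd L"
  shows "level_sum L (Suc n) t = (cos (pi * t / 2))\<^sup>2 * level_sum L n (t / 4)
    + (sin (pi * t / 2))\<^sup>2 * level_sum L n ((t - real_of_int L) / 4)"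
proof -
  let ?G = "spectrum_level L n"
  have cos_shift: "(cos (u - 2 * pi * real_of_int g))\<^sup>2 = (cos u)\<^sup>2" for u g
  proof -
    have "cos (u - 2 * pi * real_of_int g) = cos u"
      using cos_int_2pin[of g] sin_int_2pin[of g] by (simp add: cos_diff mult.commute)
    then show ?thesis by simp
  qed
  have 1: "power_mu_B (t - real_of_int (4 * g)) = (cos (pi * t / 2))\<^sup>2 * power_mu_B (t / 4 - real_of_int g)" for g
  proof -
    have "pi * (t - real_of_int (4 * g)) / 2 = pi * t / 2 - 2 * pi * real_of_int g"
      "(t - real_of_int (4 * g)) / 4 = t / 4 - real_of_int g" by (simp_all add: field_simps)
    then show ?thesis by (subst power_mu_B_scaling) (simp only: cos_shift)
  qed
  have L: "(cos (pi * (t - real_of_int L) / 2))\<^sup>2 = (sin (pi * t / 2))\<^sup>2"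
  proof -
    have c: "cos (pi * real_of_int L / 2) = 0" using cos_sin_half_pi_of_int(2)[OF assms] by simp
    then have s: "(sin (pi * real_of_int L / 2))\<^sup>2 = 1"
      using sin_cos_squared_add[of "pi * real_of_int L / 2"] by simp
    have "pi * (t - real_of_int L) / 2 = pi * t / 2 - pi * real_of_int L / 2"
      by (simp add: field_simps)
    then show ?thesis using c s by (simp only: cos_diff) (simp add: power_mult_distrib)
  qed
  have 2: "power_mu_B (t - real_of_int (4 * g + L))
      = (sin (pi * t / 2))\<^sup>2 * power_mu_B ((t - real_of_int L) / 4 - real_of_int g)" for g
  proof -
    have "pi * (t - real_of_int (4 * g + L)) / 2 = pi * (t - real_of_int L) / 2 - 2 * pi * real_of_int g"
      "(t - real_of_int (4 * g + L)) / 4 = (t - real_of_int L) / 4 - real_of_int g"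
      by (simp_all add: field_simps)
    then show ?thesis by (subst power_mu_B_scaling) (simp only: cos_shift L)
  qed
  have "level_sum L (Suc n) t = (\<Sum>g\<in>(\<lambda>g. 4 * g) ` ?G. power_mu_B (t - real_of_int g))
      + (\<Sum>g\<in>(\<lambda>g. 4 * g + L) ` ?G. power_mu_B (t - real_of_int g))"
    unfolding level_sum_def spectrum_level.simps
  proof (rule sum.union_disjoint)
    have "4 * a \<noteq> 4 * b + L" for a b
      using assms by (metis dvd_mult2 even_add even_numeral)
    then show "(\<lambda>g. 4 * g) ` ?G \<inter> (\<lambda>g. 4 * g + L) ` ?G = {}" by auto
  qed auto
  also have "(\<Sum>g\<in>(\<lambda>g. 4 * g) ` ?G. power_mu_B (t - real_of_int g))
      = (cos (pi * t / 2))\<^sup>2 * level_sum L n (t / 4)"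
    by (subst sum.reindex) (simp_all add: inj_on_def level_sum_def sum_distrib_left o_def 1 del: of_int_mult)
  also have "(\<Sum>g\<in>(\<lambda>g. 4 * g + L) ` ?G. power_mu_B (t - real_of_int g))
      = (sin (pi * t / 2))\<^sup>2 * level_sum L n ((t - real_of_int L) / 4)"
    by (subst sum.reindex) (simp_all add: inj_on_def level_sum_def sum_distrib_left o_def 2 del: of_int_mult of_int_add)
  finally show ?thesis .
qed

lemma level_sum_eq_dist:
  assumes "odd L"
  shows "\<exists>c. L2_dist2 mu_B (exponential t) (\<lambda>x. \<Sum>i\<in>real_of_int ` spectrum_level L n. c i * exponential i x)
    = 1 - level_sum L n t"
proof -
  let ?F = "real_of_int ` spectrum_level L n"
  have "level_sum L n t = (\<Sum>i\<in>?F. (norm (L2_inner mu_B (exponential t) (exponential i)))\<^sup>2)"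
    by (subst sum.reindex)
      (auto simp: inj_on_def level_sum_def L2_inner_exponential_mu_B power_mu_B_def)
  moreover have "?F \<subseteq> Gamma_set {0, real_of_int L}"
    unfolding Gamma_set_eq_Union by auto
  then have "L2_inner mu_B (exponential i) (exponential j) = (if i = j then 1 else 0)"
    if "i \<in> ?F" "j \<in> ?F" for i j
    using that Gamma_set_orthonormal[OF assms] by blast
  then have "L2_dist2 mu_B (exponential t)
        (\<lambda>x. \<Sum>i\<in>?F. L2_inner mu_B (exponential t) (exponential i) * exponential i x)
      = 1 - (\<Sum>i\<in>?F. (norm (L2_inner mu_B (exponential t) (exponential i)))\<^sup>2)"
    by (intro mu_B.L2_dist2_exponential_projection) auto
  ultimately show ?thesis by (intro exI) simp
qed

lemma level_sum_le_1:
  assumes "odd L"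
  shows "level_sum L n t \<le> 1"
proof -
  obtain c where "L2_dist2 mu_B (exponential t)
      (\<lambda>x. \<Sum>i\<in>real_of_int ` spectrum_level L n. c i * exponential i x) = 1 - level_sum L n t"
    using level_sum_eq_dist[OF assms] by blast
  moreover have "0 \<le> L2_dist2 mu_B f g" for f g by (simp add: L2_dist2_def)
  ultimately show ?thesis by (metis diff_ge_0_iff_ge)
qed

lemma level_sum_tendsto_1: "(\<lambda>n. level_sum (5 ^ k) n t) \<longlonglongrightarrow> 1"
proof -
  have odd: "odd (5 ^ k :: int)" by simp
  define h where "h t = (SUP n. level_sum (5 ^ k) n t)" for t
  have bdd: "bdd_above (range (\<lambda>n. level_sum (5 ^ k) n t))" for t
    using level_sum_le_1[OF odd] by (auto intro: bdd_aboveI[of _ 1])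
  have lim: "(\<lambda>n. level_sum (5 ^ k) n t) \<longlonglongrightarrow> h t" for t
    unfolding h_def by (rule LIMSEQ_incseq_SUP[OF bdd]) (auto simp: incseq_def intro: level_sum_mono)
  have "1 \<le> h t"
  proof (rule harmonic_ge_one[of h k])
    fix t
    have "(\<lambda>n. level_sum (5 ^ k) (Suc n) t) \<longlonglongrightarrow> (cos (pi * t / 2))\<^sup>2 * h (t / 4)
        + (sin (pi * t / 2))\<^sup>2 * h ((t - real_of_int (5 ^ k)) / 4)"
      unfolding level_sum_Suc[OF odd] by (intro tendsto_intros lim)
    with LIMSEQ_Suc[OF lim]
    show "h t = (cos (pi * t / 2))\<^sup>2 * h (t / 4) + (sin (pi * t / 2))\<^sup>2 * h ((t - 5 ^ k) / 4)"
      by (auto dest: LIMSEQ_unique)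
  next
    fix c
    have "{t. c < h t} = (\<Union>n. {t. c < level_sum (5 ^ k) n t})"
      using less_cSUP_iff[OF _ bdd] by (auto simp: h_def)
    also have "open \<dots>"
      by (intro open_UN ballI open_Collect_less continuous_level_sum continuous_on_const)
    finally show "open {t. c < h t}" .
  next
    have "1 \<le> h 0" using cSUP_upper[OF _ bdd[of 0], of 0] by (simp add: h_def level_sum_0)
    moreover have "h 0 \<le> 1" unfolding h_def by (intro cSUP_least) (use level_sum_le_1[OF odd] in auto)
    ultimately show "h 0 = 1" by simp
  qed
  moreover have "h t \<le> 1" unfolding h_def by (intro cSUP_least) (use level_sum_le_1[OF odd] in auto)
  ultimately show ?thesis using lim[of t] by simp
qed

lemma exponential_in_closed_span:
  "exponential t \<in> L2_closed_span mu_B (Gamma_set {0, 5 ^ k}) exponential"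
  unfolding L2_closed_span_def
proof (intro CollectI conjI allI impI mu_B.exponential_L2)
  fix \<epsilon> :: real assume "\<epsilon> > 0"
  then have "\<forall>\<^sub>F n in sequentially. level_sum (5 ^ k) n t > 1 - \<epsilon>"
    by (intro order_tendstoD(1)[OF level_sum_tendsto_1]) simp
  then obtain n where n: "level_sum (5 ^ k) n t > 1 - \<epsilon>"
    by (auto simp: eventually_sequentially)
  let ?F = "real_of_int ` spectrum_level (5 ^ k) n"
  obtain c where "L2_dist2 mu_B (exponential t) (\<lambda>x. \<Sum>i\<in>?F. c i * exponential i x)
      = 1 - level_sum (5 ^ k) n t"
    using level_sum_eq_dist[of "5 ^ k"] by auto
  moreover have "?F \<subseteq> Gamma_set {0, 5 ^ k}"
    using Gamma_set_eq_Union[of "5 ^ k"] by auto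
  ultimately show "\<exists>F c. finite F \<and> F \<subseteq> Gamma_set {0, 5 ^ k} \<and>
      L2_dist2 mu_B (exponential t) (\<lambda>x. \<Sum>i\<in>F. c i * exponential i x) < \<epsilon>"
    using n by (intro exI[of _ ?F] exI[of _ c]) auto
qed

theorem proposition5p1:
  fixes k :: nat
  shows "is_ONB (Gamma_set {0, 5 ^ k}) mu_B"
proof -
  let ?\<Gamma> = "Gamma_set {0, 5 ^ k}"
  let ?C = "L2_closed_span mu_B ?\<Gamma> exponential"
  have "L2_closed_subspace mu_B ?C"
    by (intro L2_closed_subspace_closed_span mu_B.exponential_L2)
  then have C: "?C = L2_functions mu_B"
    by (rule mu_B.exponentials_total[OF _ exponential_in_closed_span mu_B_bounded_support])
  show ?thesis
    unfolding is_ONB_def L2_orthonormal_basis_def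
  proof (intro conjI ballI allI impI mu_B.exponential_L2)
    show "L2_inner mu_B (exponential g) (exponential h) = (if g = h then 1 else 0)"
      if "g \<in> ?\<Gamma>" "h \<in> ?\<Gamma>" for g h
      using Gamma_set_orthonormal[of "5 ^ k" g h] that by simp
  next
    fix f and \<epsilon> :: real assume "f \<in> L2_functions mu_B" "\<epsilon> > 0"
    then have "f \<in> ?C" "\<epsilon>\<^sup>2 > 0" using C by auto
    then obtain F c where F: "finite F" "F \<subseteq> ?\<Gamma>"
        "L2_dist2 mu_B f (\<lambda>x. \<Sum>i\<in>F. c i * exponential i x) < \<epsilon>\<^sup>2"
      unfolding L2_closed_span_def by blast
    then have "L2_norm mu_B (\<lambda>x. f x - (\<Sum>i\<in>F. c i * exponential i x)) < \<epsilon>"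
      using \<open>\<epsilon> > 0\<close> unfolding L2_norm_def L2_dist2_def by (intro real_less_lsqrt) auto
    with F show "\<exists>F c. finite F \<and> F \<subseteq> ?\<Gamma> \<and>
        L2_norm mu_B (\<lambda>x. f x - (\<Sum>i\<in>F. c i * exponential i x)) < \<epsilon>" by blast
  qed
qed

end
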